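(* The singular set of a $p$-minimal surface (in the Heisenberg group $H_1$) is either (1) an isolated point; or (2) a $C^1$ smooth curve. In addition, an isolated singular point only happens in the surfaces of special type I with $\zeta_1=\mathrm{const.}$, that is, a part of the graph $u=0$ contains the origin as the isolated singular point.
   Context: The Heisenberg group $H_1$ is $\mathbb{R}^3$ with the group law $(x_1,y_1,z_1)\circ(x_2,y_2,z_2)=(x_1+x_2,\,y_1+y_2,\,z_1+z_2+y_1x_2-x_1y_2)$. Left invariant fields: $\mathring e_1=\partial_x+y\partial_z$, $\mathring e_2=\partial_y-x\partial_z$, $T=\partial_z$. Contact form $\Theta=dz+x\,dy-y\,dx$, contact bundle $\xi=\ker\Theta$, $J\mathring e_1=\mathring e_2$, $J\mathring e_2=-\mathring e_1$. The adapted metric makes $\mathring e_1,\mathring e_2,T$ orthonormal; $\nabla$ is the connection for which they are parallel. All objects are $C^\infty$ unless specified otherwise. For a surface $\Sigma\subset H_1$, a point $p$ is singular if $T_p\Sigma=\xi_p$, otherwise regular; the singular set is the set of singular points. On the regular part choose a unit field $e_1\in T\Sigma\cap\xi$ (determined up to sign) and put $e_2=Je_1$; the $p$-mean curvature $H$ is defined by $\nabla_{e_1}e_2=-He_1$, and $\Sigma$ is $p$-minimal if $H=0$ on the whole regular part. The $\alpha$-function is the function on the regular part such that $\alpha e_2+T$ is tangent to $\Sigma$; put $\hat e_2=\frac{\alpha e_2+T}{\sqrt{1+\alpha^2}}$. A $p$-minimal surface is (locally) of special type I if there are coordinates $(x,y)$ with $e_1=\partial_x$ in which $\alpha=\frac{1}{x+c_1(y)}$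 for some function $c_1$. In that case the coordinates can be normalized (normal coordinates) so that $\hat e_2=b\,\partial_y$ with $b=\frac{\alpha^2}{\sqrt{1+\alpha^2}}$ and $\alpha=\frac{1}{x+\zeta_1(y)}$; the function $\zeta_1$, unique up to a translation in $y$ and an additive constant, is called the $\zeta_1$-invariant. The graph $u=0$ is the plane $\{(x,y,0)\}\subset H_1$. *)

theory Defs
  imports "HOL-Analysis.Analysis"
begin

section \<open>Smooth maps and surfaces\<close>

text \<open>For open \<^term>\<open>S\<close> in a finite-dimensional space this is the usual class \<open>C\<^sup>k\<close>,
  phrased through iterated directional derivatives.\<close>

fun Ck_on :: "nat \<Rightarrow> 'a::euclidean_space set \<Rightarrow> ('a \<Rightarrow> 'b::euclidean_space) \<Rightarrow> bool" where
  "Ck_on 0 S f \<longleftrightarrow> continuous_on S f"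
| "Ck_on (Suc k) S f \<longleftrightarrow>
     (\<forall>x\<in>S. f differentiable (at x)) \<and>
     (\<forall>v. Ck_on k S (\<lambda>x. frechet_derivative f (at x) v))"

definition Cinf_on :: "'a::euclidean_space set \<Rightarrow> ('a \<Rightarrow> 'b::euclidean_space) \<Rightarrow> bool" where
  "Cinf_on S f \<longleftrightarrow> (\<forall>k. Ck_on k S f)"

text \<open>Smoothness on a subset that need not be open: local smooth extendability.\<close>

definition Cinf_along :: "'a::euclidean_space set \<Rightarrow> ('a \<Rightarrow> 'b::euclidean_space) \<Rightarrow> bool" where
  "Cinf_along A f \<longleftrightarrow>
     (\<forall>p\<in>A. \<exists>U F. open U \<and> p \<in> U \<and> Cinf_on U F \<and> (\<forall>q\<in>A \<inter> U. F q = f q))"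

type_synonym heis = "real \<times> real \<times> real"

definition local_param :: "heis set \<Rightarrow> (real \<times> real) set \<Rightarrow> (real \<times> real \<Rightarrow> heis) \<Rightarrow> bool" where
  "local_param M W \<phi> \<longleftrightarrow>
     open W \<and> Cinf_on W \<phi> \<and> (\<forall>w\<in>W. inj (frechet_derivative \<phi> (at w))) \<and>
     openin (top_of_set M) (\<phi> ` W) \<and> (\<exists>\<psi>. homeomorphism W (\<phi> ` W) \<phi> \<psi>)"

definition smooth_surface :: "heis set \<Rightarrow> bool" where
  "smooth_surface M \<longleftrightarrow> (\<forall>p\<in>M. \<exists>W \<phi>. local_param M W \<phi> \<and> p \<in> \<phi> ` W)"

definition tangent_space :: "heis set \<Rightarrow> heis \<Rightarrow> heis set" where
  "tangent_space M p =
     {v. \<exists>\<gamma>::real \<Rightarrow> heis. \<gamma> 0 = p \<and> (\<forall>\<^sub>F t in at 0. \<gamma> t \<in> M) \<and>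
         (\<gamma> has_vector_derivative v) (at 0)}"

text \<open>An embedded one-dimensional \<open>C\<^sup>1\<close> submanifold (without boundary).\<close>

definition C1_curve :: "heis set \<Rightarrow> bool" where
  "C1_curve C \<longleftrightarrow>
     (\<forall>p\<in>C. \<exists>U \<gamma>. open U \<and> p \<in> U \<and>
        \<gamma> C1_differentiable_on {0<..<1::real} \<and>
        (\<forall>t\<in>{0<..<1}. vector_derivative \<gamma> (at t) \<noteq> 0) \<and>
        (\<exists>\<delta>. homeomorphism {0<..<1} (C \<inter> U) \<gamma> \<delta>))"

section \<open>The Heisenberg group\<close>

fun hmul :: "heis \<Rightarrow> heis \<Rightarrow> heis" where
  "hmul (x1, y1, z1) (x2, y2, z2) = (x1 + x2, y1 + y2, z1 + z2 + y1 * x2 - x1 * y2)"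

fun he1 :: "heis \<Rightarrow> heis" where "he1 (x, y, z) = (1, 0, y)"
fun he2 :: "heis \<Rightarrow> heis" where "he2 (x, y, z) = (0, 1, - x)"
definition hT :: heis where "hT = (0, 0, 1)"

fun contact_form :: "heis \<Rightarrow> heis \<Rightarrow> real" where
  "contact_form (x, y, z) (a, b, c) = c + x * b - y * a"

definition contact_plane :: "heis \<Rightarrow> heis set" where
  "contact_plane p = {v. contact_form p v = 0}"

text \<open>The coefficients of a vector \<open>v\<close> at \<open>p\<close> in the frame \<^term>\<open>he1 p\<close>, \<^term>\<open>he2 p\<close>, \<^term>\<open>hT\<close>
  are its first two coordinates and \<^term>\<open>contact_form p v\<close>.\<close>

lemma heis_frame_expansion:
  "v = fst v *\<^sub>R he1 p + fst (snd v) *\<^sub>R he2 p + contact_form p v *\<^sub>R hT"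
  by (cases v; cases p) (simp add: hT_def algebra_simps)

definition hmetric :: "heis \<Rightarrow> heis \<Rightarrow> heis \<Rightarrow> real" where
  "hmetric p v w = fst v * fst w + fst (snd v) * fst (snd w) + contact_form p v * contact_form p w"

text \<open>\<open>J\<close> is only applied to vectors of \<^term>\<open>contact_plane p\<close>; on other vectors this is the
  extension with \<open>J T = 0\<close>.\<close>

definition hJ :: "heis \<Rightarrow> heis \<Rightarrow> heis" where
  "hJ p v = fst v *\<^sub>R he2 p - fst (snd v) *\<^sub>R he1 p"

text \<open>The derivative at \<open>p\<close> of a function on \<open>M\<close> in the direction \<open>w\<close>. A Frechet derivative
  within a surface is unique only on tangent vectors, so this is meaningful only for
  \<^term>\<open>w \<in> tangent_space M p\<close>.\<close>

definition dir_deriv :: "heis set \<Rightarrow> (heis \<Rightarrow> real) \<Rightarrow> heis \<Rightarrow> heis \<Rightarrow> real" where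
  "dir_deriv M f p w = frechet_derivative f (at p within M) w"

text \<open>The connection for which the left invariant frame is parallel, applied to a vector field
  \<open>V\<close> along \<open>M\<close> in a direction \<open>w\<close> tangent to \<open>M\<close> at \<open>p\<close>.\<close>

definition hnabla :: "heis set \<Rightarrow> heis \<Rightarrow> heis \<Rightarrow> (heis \<Rightarrow> heis) \<Rightarrow> heis" where
  "hnabla M p w V =
     dir_deriv M (\<lambda>q. fst (V q)) p w *\<^sub>R he1 p +
     dir_deriv M (\<lambda>q. fst (snd (V q))) p w *\<^sub>R he2 p +
     dir_deriv M (\<lambda>q. contact_form q (V q)) p w *\<^sub>R hT"

section \<open>Geometry of surfaces\<close>

definition singular_set :: "heis set \<Rightarrow> heis set" where
  "singular_set M = {p \<in> M. tangent_space M p = contact_plane p}"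

definition regular_part :: "heis set \<Rightarrow> heis set" where
  "regular_part M = M - singular_set M"

text \<open>\<open>e\<close> is a choice of the field \<open>e\<^sub>1\<close> on the relatively open set \<open>A\<close> of regular points.\<close>

definition char_field :: "heis set \<Rightarrow> heis set \<Rightarrow> (heis \<Rightarrow> heis) \<Rightarrow> bool" where
  "char_field M A e \<longleftrightarrow>
     openin (top_of_set M) A \<and> A \<subseteq> regular_part M \<and> Cinf_along A e \<and>
     (\<forall>q\<in>A. e q \<in> tangent_space M q \<inter> contact_plane q \<and> hmetric q (e q) (e q) = 1)"

text \<open>With \<open>e\<^sub>2 = J e\<^sub>1\<close>, the number \<open>h\<close> is the value at \<open>p\<close> of the p-mean curvature with respect to the
  choice \<open>e\<close> of \<open>e\<^sub>1\<close>.\<close>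

definition has_p_mean_curvature :: "heis set \<Rightarrow> (heis \<Rightarrow> heis) \<Rightarrow> heis \<Rightarrow> real \<Rightarrow> bool" where
  "has_p_mean_curvature M e p h \<longleftrightarrow> hnabla M p (e p) (\<lambda>q. hJ q (e q)) = - (h *\<^sub>R e p)"

text \<open>Replacing \<open>e\<close> by \<open>- e\<close> changes the sign of \<open>H\<close>, so quantifying over all local choices of
  \<open>e\<^sub>1\<close> (which exist around every regular point) expresses \<open>H = 0\<close> on the regular part.\<close>

definition p_minimal :: "heis set \<Rightarrow> bool" where
  "p_minimal M \<longleftrightarrow> smooth_surface M \<and>
     (\<forall>A e. char_field M A e \<longrightarrow> (\<forall>p\<in>A. has_p_mean_curvature M e p 0))"

definition alpha_fun :: "heis set \<Rightarrow> (heis \<Rightarrow> heis) \<Rightarrow> heis \<Rightarrow> real" where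
  "alpha_fun M e p = (THE a. a *\<^sub>R hJ p (e p) + hT \<in> tangent_space M p)"

definition e2_hat :: "heis set \<Rightarrow> (heis \<Rightarrow> heis) \<Rightarrow> heis \<Rightarrow> heis" where
  "e2_hat M e p =
     (1 / sqrt (1 + (alpha_fun M e p)\<^sup>2)) *\<^sub>R (alpha_fun M e p *\<^sub>R hJ p (e p) + hT)"

section \<open>Surfaces of special type I\<close>

text \<open>Coordinates \<open>(x, y)\<close> on an open piece of \<open>M\<close> are given by the inverse of a local
  parametrization \<open>\<phi>\<close>; the coordinate fields are the partial derivatives of \<open>\<phi>\<close>.\<close>

definition type_I_coords ::
  "heis set \<Rightarrow> (heis \<Rightarrow> heis) \<Rightarrow> (real \<times> real) set \<Rightarrow> (real \<times> real \<Rightarrow> heis) \<Rightarrow> (real \<Rightarrow> real) \<Rightarrow> bool" where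
  "type_I_coords M e W \<phi> c \<longleftrightarrow>
     local_param M W \<phi> \<and> char_field M (\<phi> ` W) e \<and>
     (\<forall>(x, y)\<in>W.
        e (\<phi> (x, y)) = frechet_derivative \<phi> (at (x, y)) (1, 0) \<and>
        x + c y \<noteq> 0 \<and> alpha_fun M e (\<phi> (x, y)) = 1 / (x + c y))"

definition special_type_I :: "heis set \<Rightarrow> bool" where
  "special_type_I M \<longleftrightarrow> p_minimal M \<and>
     (\<forall>q\<in>regular_part M. \<exists>e W \<phi> c. type_I_coords M e W \<phi> c \<and> q \<in> \<phi> ` W)"

definition normal_coords ::
  "heis set \<Rightarrow> (heis \<Rightarrow> heis) \<Rightarrow> (real \<times> real) set \<Rightarrow> (real \<times> real \<Rightarrow> heis) \<Rightarrow> (real \<Rightarrow> real) \<Rightarrow> bool" where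
  "normal_coords M e W \<phi> \<zeta> \<longleftrightarrow>
     type_I_coords M e W \<phi> \<zeta> \<and>
     (\<forall>(x, y)\<in>W. let a = alpha_fun M e (\<phi> (x, y)) in
        e2_hat M e (\<phi> (x, y)) =
          (a\<^sup>2 / sqrt (1 + a\<^sup>2)) *\<^sub>R frechet_derivative \<phi> (at (x, y)) (0, 1))"

text \<open>The field \<open>e\<close> is fixed on the whole regular part because \<open>- e\<close> leads to \<open>- \<zeta>\<close>. The regular part
  need not be covered by a single chart: around an isolated singular point \<open>y\<close> is an angle.\<close>

definition has_zeta1_invariant :: "heis set \<Rightarrow> (heis \<Rightarrow> heis) \<Rightarrow> (real \<Rightarrow> real) \<Rightarrow> bool" where
  "has_zeta1_invariant M e \<zeta> \<longleftrightarrow>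
     char_field M (regular_part M) e \<and>
     (\<forall>q\<in>regular_part M. \<exists>W \<phi>. normal_coords M e W \<phi> \<zeta> \<and> q \<in> \<phi> ` W)"

definition graph_zero :: "heis set" where
  "graph_zero = {(x, y, z). z = 0}"

end

(*
Near a singular point the surface is a graph z = u(x, y). With F = u_x - y and G = u_y + x, the
singular points are the common zeros of F and G, and p-minimality says that the direction of
(F, G) is constant along the field W = (G, -F), whose integral curves are the characteristic lines.
Moreover G_x - F_y = 2.

If the derivative of (F, G) at a singular point is not invertible, some fixed direction n has
d(n . (F, G)) = 0 there, and the component B of (F, G) orthogonal to n has derivative 2 along n.
The equation then forces n . (F, G) = 0 wherever B = 0, so the singular set is the curve B = 0.

If the derivative is invertible, the leading order of the equation makes it the rotation
(F, G) ~ (-eta, xi) in coordinates (xi, eta) centred at the singular point. A maximum principle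
along W then gives xi F + eta G = 0, so u is affine on rays, the surface is a piece of the contact
plane, and polar coordinates are normal coordinates with zeta_1 = 0.
*)
theory Submission
  imports Defs
begin


section \<open>Calculus of smooth maps\<close>

text \<open>The curl \<open>G_x - F_y = 2\<close> is nonzero because the contact bundle is not
  integrable, and both cases live on it: it is the source of the derivative 2 of \<open>B\<close>,
  and it fixes the scale of the rotation, which the equation alone determines only up to a factor.
  That the equation determines this much comes from invertibility: the first-order values of
  \<open>(F, G)\<close> then fill the plane, so the leading term is a quadratic form that vanishes
  identically.

  No characteristic line is ever integrated. The equation serves only as a pointwise identity,
  differentiated once along \<open>n\<close> in the degenerate case and evaluated at a maximum in
  the other. It is therefore kept in a form cleared of the norm of \<open>(F, G)\<close>, which is
  smooth across the singular point.

  The alternative is decided at each singular point separately. A curve point is never isolated and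
  a flat point always is, so a component without isolated points consists of curve points only, and
  its local arcs fit together.\<close>

abbreviation pd :: "'a::euclidean_space \<Rightarrow> ('a \<Rightarrow> 'b::euclidean_space) \<Rightarrow> 'a \<Rightarrow> 'b" where
  "pd v f \<equiv> (\<lambda>x. frechet_derivative f (at x) v)"

section \<open>Closure properties of the smoothness classes\<close>

lemma Ck_on_imp_continuous_on: "Ck_on k S f \<Longrightarrow> continuous_on S f"
  by (cases k) (auto simp: differentiable_imp_continuous_within
      intro!: continuous_at_imp_continuous_on)

text \<open>Agreement on an open set carries over to derivatives at each of its points, so the
  induction can pass to the directional derivatives.\<close>

lemma Ck_on_cong:
  assumes "open S" "\<And>x. x \<in> S \<Longrightarrow> f x = g x" "Ck_on k S f"
  shows "Ck_on k S g"
  using assms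
proof (induction k arbitrary: f g)
  case 0
  then show ?case by (simp cong: continuous_on_cong)
next
  case (Suc k)
  have d: "g differentiable at x" "frechet_derivative f (at x) = frechet_derivative g (at x)"
    if "x \<in> S" for x
  proof -
    have f: "f differentiable at x" using Suc that by simp
    obtain f' where f': "(f has_derivative f') (at x)"
      using f differentiable_def by blast
    have "(g has_derivative f') (at x)"
      by (rule has_derivative_transform_within_open[OF f' \<open>open S\<close> that]) (use Suc in auto)
    then show "g differentiable at x" "frechet_derivative f (at x) = frechet_derivative g (at x)"
      using f' frechet_derivative_at differentiable_def by metis+
  qed
  show ?case
    unfolding Ck_on.simps
  proof (intro conjI ballI allI)
    show "Ck_on k S (\<lambda>x. frechet_derivative g (at x) v)" for v
    proof (rule Suc.IH[OF \<open>open S\<close>])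
      show "Ck_on k S (\<lambda>x. frechet_derivative f (at x) v)" using Suc.prems by simp
    qed (use d in auto)
  qed (use d in auto)
qed

text \<open>Uniqueness of derivatives lets an explicit formula \<open>f'\<close> stand in for
  \<open>frechet_derivative\<close>; the closure inductions below enter through this rule.\<close>

lemma Ck_on_SucI:
  assumes "open S" "\<And>x. x \<in> S \<Longrightarrow> (f has_derivative f' x) (at x)"
    and "\<And>v. Ck_on k S (\<lambda>x. f' x v)"
  shows "Ck_on (Suc k) S f"
  unfolding Ck_on.simps
proof (intro conjI ballI allI)
  show "f differentiable at x" if "x \<in> S" for x
    using assms(2)[OF that] differentiable_def by blast
  show "Ck_on k S (\<lambda>x. frechet_derivative f (at x) v)" for v
    by (rule Ck_on_cong[OF \<open>open S\<close> _ assms(3)[of v]])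
      (use assms(2) frechet_derivative_at in metis)
qed

lemma Ck_on_Suc_has_derivative:
  "Ck_on (Suc k) S f \<Longrightarrow> x \<in> S \<Longrightarrow> (f has_derivative frechet_derivative f (at x)) (at x)"
  by (simp add: frechet_derivative_works)

lemma Ck_on_Suc_pd: "Ck_on (Suc k) S f \<Longrightarrow> Ck_on k S (pd v f)"
  by simp

lemma Ck_on_Suc_imp: "Ck_on (Suc k) S f \<Longrightarrow> Ck_on k S f"
proof (induction k arbitrary: f)
  case 0
  then show ?case using Ck_on_imp_continuous_on by (metis Ck_on.simps(1))
next
  case (Suc k)
  then show ?case by (meson Ck_on.simps(2))
qed

lemma Ck_on_subset: "T \<subseteq> S \<Longrightarrow> Ck_on k S f \<Longrightarrow> Ck_on k T f"
  by (induction k arbitrary: f) (auto intro: continuous_on_subset)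

lemma Ck_on_const: "open S \<Longrightarrow> Ck_on k S (\<lambda>x. c)"
proof (induction k arbitrary: c)
  case (Suc k)
  then show ?case by (intro Ck_on_SucI[where f' = "\<lambda>x v. 0"]) auto
qed simp

lemma Ck_on_linear:
  assumes "open S" "bounded_linear L" "Ck_on k S f"
  shows "Ck_on k S (\<lambda>x. L (f x))"
  using assms(3)
proof (induction k arbitrary: f)
  case 0
  then show ?case
    using linear_continuous_on_compose[OF _ bounded_linear.linear[OF assms(2)]] by simp
next
  case (Suc k)
  show ?case
  proof (rule Ck_on_SucI[OF assms(1)])
    show "((\<lambda>x. L (f x)) has_derivative (\<lambda>v. L (frechet_derivative f (at x) v))) (at x)" if "x \<in> S" for x
      using bounded_linear.has_derivative[OF assms(2) Ck_on_Suc_has_derivative[OF Suc.prems that]] .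
    show "Ck_on k S (\<lambda>x. L (frechet_derivative f (at x) v))" for v
      using Suc.IH Suc.prems by simp
  qed
qed

lemma Ck_on_bounded_linear: "open S \<Longrightarrow> bounded_linear L \<Longrightarrow> Ck_on k S L"
  by (induction k) (auto intro!: Ck_on_SucI[where f' = "\<lambda>x. L"] Ck_on_const linear_continuous_on
      bounded_linear_imp_has_derivative simp del: Ck_on.simps(2))

lemma Ck_on_add:
  assumes "open S" "Ck_on k S f" "Ck_on k S g"
  shows "Ck_on k S (\<lambda>x. f x + g x)"
  using assms(2,3)
proof (induction k arbitrary: f g)
  case 0
  then show ?case by (simp add: continuous_on_add)
next
  case (Suc k)
  show ?case
  proof (rule Ck_on_SucI[OF assms(1)])
    show "((\<lambda>x. f x + g x) has_derivative
        (\<lambda>v. frechet_derivative f (at x) v + frechet_derivative g (at x) v)) (at x)" if "x \<in> S" for x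
      using Suc.prems that by (intro has_derivative_add Ck_on_Suc_has_derivative)
    show "Ck_on k S (\<lambda>x. frechet_derivative f (at x) v + frechet_derivative g (at x) v)" for v
      using Suc.IH Suc.prems by simp
  qed
qed

lemma Ck_on_sum:
  "open S \<Longrightarrow> (\<And>i. i \<in> I \<Longrightarrow> Ck_on k S (f i)) \<Longrightarrow> Ck_on k S (\<lambda>x. \<Sum>i\<in>I. f i x)"
  by (induction I rule: infinite_finite_induct) (auto intro: Ck_on_const Ck_on_add)

text \<open>One induction serves products, scalar multiples and inner products. Each Leibniz term
  keeps one factor undifferentiated, whence the appeals to \<open>Ck_on_Suc_imp\<close>.\<close>

lemma Ck_on_bilinear:
  assumes "open S" "bounded_bilinear B" "Ck_on k S f" "Ck_on k S g"
  shows "Ck_on k S (\<lambda>x. B (f x) (g x))"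
  using assms(3,4)
proof (induction k arbitrary: f g)
  case 0
  then show ?case using bounded_bilinear.continuous_on[OF assms(2)] by simp
next
  case (Suc k)
  show ?case
  proof (rule Ck_on_SucI[OF assms(1)])
    show "((\<lambda>x. B (f x) (g x)) has_derivative
        (\<lambda>v. B (f x) (frechet_derivative g (at x) v) + B (frechet_derivative f (at x) v) (g x))) (at x)"
      if "x \<in> S" for x
      using Suc.prems that by (intro bounded_bilinear.FDERIV[OF assms(2)] Ck_on_Suc_has_derivative)
    show "Ck_on k S (\<lambda>x. B (f x) (frechet_derivative g (at x) v) + B (frechet_derivative f (at x) v) (g x))" for v
      by (intro Ck_on_add assms(1) Suc.IH Ck_on_Suc_imp[OF Suc.prems(1)] Ck_on_Suc_imp[OF Suc.prems(2)])
        (use Suc.prems in auto)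
  qed
qed

text \<open>\<open>Ck_on\<close> controls the derivatives of \<open>g\<close> in fixed directions
  only, while the chain rule feeds \<open>g\<close> a direction that moves with \<open>x\<close>.
  Expanding this direction over the basis gives a sum of products, to which the bilinear rule and
  the induction hypothesis apply.\<close>

lemma Ck_on_compose:
  fixes f :: "'a::euclidean_space \<Rightarrow> 'b::euclidean_space" and g :: "'b \<Rightarrow> 'c::euclidean_space"
  assumes "open S" "f ` S \<subseteq> T" "Ck_on k S f" "Ck_on k T g"
  shows "Ck_on k S (\<lambda>x. g (f x))"
  using assms(3,4)
proof (induction k arbitrary: g)
  case 0
  then show ?case using assms(2) continuous_on_compose2 by auto
next
  case (Suc k)
  have fx: "f x \<in> T" if "x \<in> S" for x using that assms(2) by auto
  show ?case
  proof (rule Ck_on_SucI[OF assms(1)])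
    show "((\<lambda>x. g (f x)) has_derivative
        (\<lambda>v. \<Sum>i\<in>Basis. (frechet_derivative f (at x) v \<bullet> i) *\<^sub>R frechet_derivative g (at (f x)) i)) (at x)"
      if "x \<in> S" for x
    proof -
      have g: "(g has_derivative frechet_derivative g (at (f x))) (at (f x))"
        using Ck_on_Suc_has_derivative[OF Suc.prems(2)] fx that by blast
      then have lin: "linear (frechet_derivative g (at (f x)))"
        by (rule has_derivative_linear)
      have "frechet_derivative g (at (f x)) (frechet_derivative f (at x) v)
        = (\<Sum>i\<in>Basis. (frechet_derivative f (at x) v \<bullet> i) *\<^sub>R frechet_derivative g (at (f x)) i)" for v
        by (subst euclidean_representation[of "frechet_derivative f (at x) v", symmetric])
          (simp only: linear_sum[OF lin] linear_scale[OF lin])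
      then show ?thesis
        using has_derivative_compose[OF Ck_on_Suc_has_derivative[OF Suc.prems(1) that] g] by simp
    qed
    show "Ck_on k S (\<lambda>x. \<Sum>i\<in>Basis. (frechet_derivative f (at x) v \<bullet> i) *\<^sub>R frechet_derivative g (at (f x)) i)" for v
    proof (intro Ck_on_sum assms(1) Ck_on_bilinear[OF _ bounded_bilinear_scaleR])
      show "Ck_on k S (\<lambda>x. frechet_derivative f (at x) v \<bullet> i)" for i
        by (intro Ck_on_bilinear[OF _ bounded_bilinear_inner] assms(1) Ck_on_const)
          (use Suc.prems in auto)
      show "Ck_on k S (\<lambda>x. frechet_derivative g (at (f x)) i)" for i
        using Suc.prems by (intro Suc.IH Ck_on_Suc_imp[OF Suc.prems(1)]) simp
    qed
  qed
qed

lemma Ck_on_real_SucI: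
  fixes f :: "real \<Rightarrow> real"
  assumes "open S" "\<And>x. x \<in> S \<Longrightarrow> (f has_real_derivative f' x) (at x)" "Ck_on k S f'"
  shows "Ck_on (Suc k) S f"
proof (rule Ck_on_SucI[OF assms(1)])
  show "(f has_derivative (\<lambda>v. v * f' x)) (at x)" if "x \<in> S" for x
    using assms(2)[OF that] by (simp add: has_field_derivative_def mult.commute[of _ "f' x"])
  show "Ck_on k S (\<lambda>x. v * f' x)" for v
    by (rule Ck_on_linear[OF assms(1) bounded_linear_mult_right assms(3)])
qed

lemma Cinf_on_imp_Ck: "Cinf_on S f \<Longrightarrow> Ck_on k S f"
  by (simp add: Cinf_on_def)

lemma Cinf_on_cong: "open S \<Longrightarrow> (\<And>x. x \<in> S \<Longrightarrow> f x = g x) \<Longrightarrow> Cinf_on S f \<Longrightarrow> Cinf_on S g"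
  using Ck_on_cong unfolding Cinf_on_def by blast

lemma Cinf_on_subset: "T \<subseteq> S \<Longrightarrow> Cinf_on S f \<Longrightarrow> Cinf_on T f"
  using Ck_on_subset unfolding Cinf_on_def by blast

lemma Cinf_on_pd: "Cinf_on S f \<Longrightarrow> Cinf_on S (pd v f)"
  unfolding Cinf_on_def using Ck_on_Suc_pd by blast

lemma Cinf_on_has_derivative:
  "Cinf_on S f \<Longrightarrow> x \<in> S \<Longrightarrow> (f has_derivative frechet_derivative f (at x)) (at x)"
  using Ck_on_Suc_has_derivative Cinf_on_imp_Ck by blast

lemma Cinf_on_imp_continuous_on: "Cinf_on S f \<Longrightarrow> continuous_on S f"
  using Ck_on_imp_continuous_on Cinf_on_imp_Ck by blast

lemma Cinf_on_const: "open S \<Longrightarrow> Cinf_on S (\<lambda>x. c)"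
  by (simp add: Cinf_on_def Ck_on_const)

lemma Cinf_on_linear: "open S \<Longrightarrow> bounded_linear L \<Longrightarrow> Cinf_on S f \<Longrightarrow> Cinf_on S (\<lambda>x. L (f x))"
  by (simp add: Cinf_on_def Ck_on_linear)

lemma Cinf_on_bounded_linear: "open S \<Longrightarrow> bounded_linear L \<Longrightarrow> Cinf_on S L"
  by (simp add: Cinf_on_def Ck_on_bounded_linear)

lemma Cinf_on_add: "open S \<Longrightarrow> Cinf_on S f \<Longrightarrow> Cinf_on S g \<Longrightarrow> Cinf_on S (\<lambda>x. f x + g x)"
  by (simp add: Cinf_on_def Ck_on_add)

lemma Cinf_on_minus: "open S \<Longrightarrow> Cinf_on S f \<Longrightarrow> Cinf_on S (\<lambda>x. - f x)"
  by (rule Cinf_on_linear[OF _ bounded_linear_minus[OF bounded_linear_ident]])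

lemma Cinf_on_diff: "open S \<Longrightarrow> Cinf_on S f \<Longrightarrow> Cinf_on S g \<Longrightarrow> Cinf_on S (\<lambda>x. f x - g x)"
  using Cinf_on_add[of S f "\<lambda>x. - g x"] Cinf_on_minus by fastforce

lemma Cinf_on_scaleR:
  "open S \<Longrightarrow> Cinf_on S f \<Longrightarrow> Cinf_on S g \<Longrightarrow> Cinf_on S (\<lambda>x. f x *\<^sub>R g x)"
  by (simp add: Cinf_on_def Ck_on_bilinear[OF _ bounded_bilinear_scaleR])

lemma Cinf_on_mult:
  fixes f g :: "'a::euclidean_space \<Rightarrow> real"
  shows "open S \<Longrightarrow> Cinf_on S f \<Longrightarrow> Cinf_on S g \<Longrightarrow> Cinf_on S (\<lambda>x. f x * g x)"
  by (simp add: Cinf_on_def Ck_on_bilinear[OF _ bounded_bilinear_mult])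

lemma Cinf_on_compose:
  fixes f :: "'a::euclidean_space \<Rightarrow> 'b::euclidean_space" and g :: "'b \<Rightarrow> 'c::euclidean_space"
  shows "open S \<Longrightarrow> f ` S \<subseteq> T \<Longrightarrow> Cinf_on S f \<Longrightarrow> Cinf_on T g \<Longrightarrow> Cinf_on S (\<lambda>x. g (f x))"
  unfolding Cinf_on_def using Ck_on_compose by blast

lemma Cinf_on_fst: "open S \<Longrightarrow> Cinf_on S f \<Longrightarrow> Cinf_on S (\<lambda>x. fst (f x))"
  by (rule Cinf_on_linear[OF _ bounded_linear_fst])

lemma Cinf_on_snd: "open S \<Longrightarrow> Cinf_on S f \<Longrightarrow> Cinf_on S (\<lambda>x. snd (f x))"
  by (rule Cinf_on_linear[OF _ bounded_linear_snd])

lemma Cinf_on_Pair: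
  assumes "open S" "Cinf_on S f" "Cinf_on S g"
  shows "Cinf_on S (\<lambda>x. (f x, g x))"
proof -
  have "bounded_linear (\<lambda>y. (y, 0::'c))" "bounded_linear (\<lambda>z. (0::'b, z))"
    by (intro bounded_linear_Pair bounded_linear_ident bounded_linear_zero)+
  from Cinf_on_add[OF assms(1) Cinf_on_linear[OF assms(1) this(1) assms(2)]
      Cinf_on_linear[OF assms(1) this(2) assms(3)]]
  show ?thesis by simp
qed

lemma Cinf_on_ident: "open S \<Longrightarrow> Cinf_on S (\<lambda>x. x)"
  by (rule Cinf_on_bounded_linear[OF _ bounded_linear_ident])

text \<open>The derivative is a polynomial in the function itself, so the induction feeds itself.
  The same bootstrapping treats \<open>sqrt\<close>, through its reciprocal, and the pair
  \<open>sin\<close>, \<open>cos\<close>.\<close>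

lemma Ck_on_inverse: "Ck_on k (- {0}) (inverse :: real \<Rightarrow> real)"
proof (induction k)
  case 0
  then show ?case by (auto intro!: continuous_intros)
next
  case (Suc k)
  have o: "open (- {0::real})" by auto
  show ?case
  proof (rule Ck_on_real_SucI[OF o])
    show "(inverse has_real_derivative - (inverse x * inverse x)) (at x)" if "x \<in> - {0}" for x :: real
      using that by (auto intro!: derivative_eq_intros)
    show "Ck_on k (- {0}) (\<lambda>x::real. - (inverse x * inverse x))"
      by (intro Ck_on_linear[OF o bounded_linear_minus[OF bounded_linear_ident]]
          Ck_on_bilinear[OF o bounded_bilinear_mult] Suc.IH)
  qed
qed

lemma Ck_on_sqrt: "Ck_on k {0<..} sqrt"
proof (induction k)
  case 0
  then show ?case by (auto intro!: continuous_intros)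
next
  case (Suc k)
  have o: "open {0::real<..}" by auto
  show ?case
  proof (rule Ck_on_real_SucI[OF o])
    show "(sqrt has_real_derivative inverse (sqrt x) / 2) (at x)" if "x \<in> {0<..}" for x :: real
      using DERIV_real_sqrt that by simp
    have "Ck_on k {0<..} (\<lambda>x. inverse (sqrt x))"
      by (rule Ck_on_compose[OF o _ Suc.IH Ck_on_inverse]) auto
    then show "Ck_on k {0<..} (\<lambda>x. inverse (sqrt x) / 2)"
      using Ck_on_linear[OF o bounded_linear_divide] by blast
  qed
qed

lemma Ck_on_sin_cos: "Ck_on k UNIV (sin :: real \<Rightarrow> real) \<and> Ck_on k UNIV (cos :: real \<Rightarrow> real)"
proof (induction k)
  case 0
  then show ?case by (auto intro!: continuous_intros)
next
  case (Suc k)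
  have "Ck_on k UNIV (\<lambda>x::real. - sin x)"
    by (rule Ck_on_linear[OF open_UNIV bounded_linear_minus[OF bounded_linear_ident]])
      (rule conjunct1[OF Suc.IH])
  then show ?case
    using Ck_on_real_SucI[OF open_UNIV DERIV_sin, of k] Ck_on_real_SucI[OF open_UNIV DERIV_cos, of k]
      Suc.IH by metis
qed

lemma Cinf_on_inverse:
  fixes f :: "'a::euclidean_space \<Rightarrow> real"
  shows "open S \<Longrightarrow> Cinf_on S f \<Longrightarrow> (\<And>x. x \<in> S \<Longrightarrow> f x \<noteq> 0) \<Longrightarrow> Cinf_on S (\<lambda>x. inverse (f x))"
  by (rule Cinf_on_compose[where T = "- {0}"]) (auto simp: Cinf_on_def Ck_on_inverse)

lemma Cinf_on_divide:
  fixes f g :: "'a::euclidean_space \<Rightarrow> real"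
  shows "open S \<Longrightarrow> Cinf_on S f \<Longrightarrow> Cinf_on S g \<Longrightarrow> (\<And>x. x \<in> S \<Longrightarrow> g x \<noteq> 0) \<Longrightarrow>
    Cinf_on S (\<lambda>x. f x / g x)"
  unfolding divide_inverse by (intro Cinf_on_mult Cinf_on_inverse)

lemma Cinf_on_sqrt:
  fixes f :: "'a::euclidean_space \<Rightarrow> real"
  shows "open S \<Longrightarrow> Cinf_on S f \<Longrightarrow> (\<And>x. x \<in> S \<Longrightarrow> f x > 0) \<Longrightarrow> Cinf_on S (\<lambda>x. sqrt (f x))"
  by (rule Cinf_on_compose[where T = "{0<..}"]) (auto simp: Cinf_on_def Ck_on_sqrt)

lemma Cinf_on_sin:
  fixes f :: "'a::euclidean_space \<Rightarrow> real"
  shows "open S \<Longrightarrow> Cinf_on S f \<Longrightarrow> Cinf_on S (\<lambda>x. sin (f x))"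
  by (rule Cinf_on_compose[where T = UNIV]) (auto simp: Cinf_on_def Ck_on_sin_cos)

lemma Cinf_on_cos:
  fixes f :: "'a::euclidean_space \<Rightarrow> real"
  shows "open S \<Longrightarrow> Cinf_on S f \<Longrightarrow> Cinf_on S (\<lambda>x. cos (f x))"
  by (rule Cinf_on_compose[where T = UNIV]) (auto simp: Cinf_on_def Ck_on_sin_cos)

lemmas Cinf_intros = Cinf_on_const Cinf_on_ident Cinf_on_add Cinf_on_minus Cinf_on_diff
  Cinf_on_mult Cinf_on_scaleR Cinf_on_Pair Cinf_on_fst Cinf_on_snd Cinf_on_inverse Cinf_on_divide
  Cinf_on_sqrt Cinf_on_sin Cinf_on_cos Cinf_on_pd


section \<open>Derivatives along lines and the symmetry of second derivatives\<close>

lemma Cinf_on_line_derivative: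
  fixes f :: "'a::euclidean_space \<Rightarrow> real"
  assumes "Cinf_on S f" "p + t *\<^sub>R v \<in> S"
  shows "((\<lambda>t. f (p + t *\<^sub>R v)) has_real_derivative pd v f (p + t *\<^sub>R v)) (at t)"
proof -
  let ?D = "frechet_derivative f (at (p + t *\<^sub>R v))"
  have f: "(f has_derivative ?D) (at (p + t *\<^sub>R v))"
    using Cinf_on_has_derivative[OF assms] .
  have "((\<lambda>t. p + t *\<^sub>R v) has_derivative (\<lambda>s. s *\<^sub>R v)) (at t)"
    by (auto intro!: derivative_eq_intros)
  from has_derivative_compose[OF this f]
  have "((\<lambda>t. f (p + t *\<^sub>R v)) has_derivative (\<lambda>s. ?D (s *\<^sub>R v))) (at t)" .
  moreover have "(\<lambda>s. ?D (s *\<^sub>R v)) = (*) (?D v)"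
    using linear_scale[OF has_derivative_linear[OF f]] by (auto simp: fun_eq_iff)
  ultimately show ?thesis by (simp add: has_field_derivative_def)
qed

text \<open>Two mean value theorems, one along \<open>v\<close> for the increment in direction
  \<open>w\<close>, one along \<open>w\<close> for the resulting derivative. The left-hand side is
  symmetric in \<open>v\<close> and \<open>w\<close>, the right-hand side not visibly so.\<close>

lemma second_difference_mean_value:
  fixes f :: "'a::euclidean_space \<Rightarrow> real"
  assumes "Cinf_on S f" "h > 0" "cball q (h * (norm v + norm w)) \<subseteq> S"
  obtains p where "p \<in> cball q (h * (norm v + norm w))"
    "f (q + h *\<^sub>R v + h *\<^sub>R w) - f (q + h *\<^sub>R v) - f (q + h *\<^sub>R w) + f q = h\<^sup>2 * pd w (pd v f) p"
proof -
  have ball: "q + t *\<^sub>R v + s *\<^sub>R w \<in> cball q (h * (norm v + norm w))"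
    if "0 \<le> t" "t \<le> h" "0 \<le> s" "s \<le> h" for t s
  proof -
    have "norm (t *\<^sub>R v + s *\<^sub>R w) \<le> t * norm v + s * norm w"
      using norm_triangle_ineq[of "t *\<^sub>R v" "s *\<^sub>R w"] that by simp
    also have "\<dots> \<le> h * norm v + h * norm w"
      by (intro add_mono mult_right_mono) (use that in auto)
    also have "dist q (q + t *\<^sub>R v + s *\<^sub>R w) = norm (t *\<^sub>R v + s *\<^sub>R w)"
      by (metis add.assoc add_diff_cancel_left' dist_commute dist_norm)
    ultimately show ?thesis by (simp add: distrib_left)
  qed
  have d1: "((\<lambda>t. f (q + h *\<^sub>R w + t *\<^sub>R v) - f (q + t *\<^sub>R v)) has_real_derivative
      pd v f (q + h *\<^sub>R w + t *\<^sub>R v) - pd v f (q + t *\<^sub>R v)) (at t)" if "0 \<le> t" "t \<le> h" for t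
    using ball[of t h] ball[of t 0] that assms
    by (intro DERIV_diff Cinf_on_line_derivative[OF assms(1)]) (auto simp: algebra_simps)
  obtain z where z: "0 < z" "z < h" "(f (q + h *\<^sub>R w + h *\<^sub>R v) - f (q + h *\<^sub>R v)) - (f (q + h *\<^sub>R w) - f q)
     = h * (pd v f (q + h *\<^sub>R w + z *\<^sub>R v) - pd v f (q + z *\<^sub>R v))"
    using MVT2[OF assms(2) d1] by auto
  have d2: "((\<lambda>s. pd v f (q + z *\<^sub>R v + s *\<^sub>R w)) has_real_derivative
      pd w (pd v f) (q + z *\<^sub>R v + s *\<^sub>R w)) (at s)" if "0 \<le> s" "s \<le> h" for s
    using ball[of z s] that assms z
    by (intro Cinf_on_line_derivative[OF Cinf_on_pd[OF assms(1)]]) auto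
  obtain y where y: "0 < y" "y < h" "pd v f (q + z *\<^sub>R v + h *\<^sub>R w) - pd v f (q + z *\<^sub>R v)
     = h * pd w (pd v f) (q + z *\<^sub>R v + y *\<^sub>R w)"
    using MVT2[OF assms(2) d2] by auto
  show thesis
  proof (rule that[of "q + z *\<^sub>R v + y *\<^sub>R w"])
    have "pd v f (q + h *\<^sub>R w + z *\<^sub>R v) - pd v f (q + z *\<^sub>R v) = h * pd w (pd v f) (q + z *\<^sub>R v + y *\<^sub>R w)"
      using y(3) by (simp add: add.commute add.left_commute)
    with z(3) show "f (q + h *\<^sub>R v + h *\<^sub>R w) - f (q + h *\<^sub>R v) - f (q + h *\<^sub>R w) + f q = h\<^sup>2 * pd w (pd v f) (q + z *\<^sub>R v + y *\<^sub>R w)"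
      by (simp add: add.commute add.left_commute power2_eq_square)
  qed (use ball y z in auto)
qed

text \<open>Schwarz's argument: the symmetric second difference forces \<open>?a p1 = ?b p2\<close>
  at two points arbitrarily close to \<open>q\<close>, and continuity with tolerance half the
  supposed gap gives a contradiction.\<close>

lemma pd_commute:
  fixes f :: "'a::euclidean_space \<Rightarrow> real"
  assumes "open S" "Cinf_on S f" "q \<in> S"
  shows "pd w (pd v f) q = pd v (pd w f) q"
proof (rule ccontr)
  let ?a = "pd w (pd v f)" and ?b = "pd v (pd w f)"
  assume ne: "?a q \<noteq> ?b q"
  define e where "e = \<bar>?a q - ?b q\<bar> / 2"
  have "e > 0" using ne by (simp add: e_def)
  have c: "isCont ?a q" "isCont ?b q"
    using Cinf_on_imp_continuous_on[OF Cinf_on_pd[OF Cinf_on_pd[OF assms(2)]]] assms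
      continuous_on_eq_continuous_at by blast+
  obtain d1 where d1: "d1 > 0" "\<And>x. dist x q < d1 \<Longrightarrow> dist (?a x) (?a q) < e"
    using c(1) \<open>e > 0\<close> unfolding continuous_at_eps_delta by blast
  obtain d2 where d2: "d2 > 0" "\<And>x. dist x q < d2 \<Longrightarrow> dist (?b x) (?b q) < e"
    using c(2) \<open>e > 0\<close> unfolding continuous_at_eps_delta by blast
  obtain r where r: "r > 0" "cball q r \<subseteq> S"
    using assms open_contains_cball by blast
  define m where "m = min r (min (d1/2) (d2/2))"
  have m: "m > 0" "m \<le> r" "m < d1" "m < d2" using r d1(1) d2(1) by (auto simp: m_def)
  \<comment> \<open>The summand 1 keeps the denominator positive when \<open>v\<close> and
    \<open>w\<close> both vanish.\<close>
  define h where "h = m / (norm v + norm w + 1)"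
  have nn: "norm v + norm w + 1 > 0" by (smt (verit) norm_ge_zero)
  then have h: "h > 0" using m by (simp add: h_def)
  have "h * (norm v + norm w) \<le> h * (norm v + norm w + 1)" using h by (simp add: mult_left_mono)
  also have "\<dots> = m" using nn by (simp add: h_def)
  finally have hm: "h * (norm v + norm w) \<le> m" .
  then have sub: "cball q (h * (norm v + norm w)) \<subseteq> S" "cball q (h * (norm w + norm v)) \<subseteq> S"
    using r m by (auto simp: add.commute)
  obtain p1 where p1: "p1 \<in> cball q (h * (norm v + norm w))"
    "f (q + h *\<^sub>R v + h *\<^sub>R w) - f (q + h *\<^sub>R v) - f (q + h *\<^sub>R w) + f q = h\<^sup>2 * ?a p1"
    using second_difference_mean_value[OF assms(2) h sub(1)] by blast
  obtain p2 where p2: "p2 \<in> cball q (h * (norm w + norm v))"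
    "f (q + h *\<^sub>R w + h *\<^sub>R v) - f (q + h *\<^sub>R w) - f (q + h *\<^sub>R v) + f q = h\<^sup>2 * ?b p2"
    using second_difference_mean_value[OF assms(2) h sub(2)] by blast
  have eq: "q + h *\<^sub>R w + h *\<^sub>R v = q + h *\<^sub>R v + h *\<^sub>R w" by (simp add: add.commute add.left_commute)
  have "h\<^sup>2 * ?a p1 = h\<^sup>2 * ?b p2" using p1(2) p2(2) unfolding eq by linarith
  then have "?a p1 = ?b p2" using h by simp
  moreover have "dist p1 q < d1" "dist p2 q < d2"
    using p1(1) p2(1) hm m by (auto simp: dist_commute add.commute)
  ultimately have "dist (?a p1) (?a q) < e" "dist (?a p1) (?b q) < e"
    using d1(2) d2(2) by metis+
  then show False using ne dist_triangle_half_l[of "?a q" "?a p1" "2 * e" "?b q"]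
    by (simp add: e_def dist_commute dist_real_def)
qed

section \<open>A smooth inverse function theorem in the plane\<close>

lemma plane_linear_expand:
  fixes D :: "real \<times> real \<Rightarrow> 'b::real_vector"
  assumes "linear D"
  shows "D (x, y) = x *\<^sub>R D (1, 0) + y *\<^sub>R D (0, 1)"
proof -
  have "(x, y) = x *\<^sub>R (1, 0) + y *\<^sub>R (0::real, 1::real)" by simp
  then show ?thesis
    by (simp only: linear_add[OF assms] linear_scale[OF assms])
qed

text \<open>Cramer's rule. Its purpose is to show the inverse of a derivative as a rational
  expression in the entries, hence as something smooth in the base point.\<close>

lemma plane_inverse_cramer:
  fixes D :: "real \<times> real \<Rightarrow> real \<times> real"
  assumes "linear D" "inj D"
  defines "d \<equiv> fst (D (1, 0)) * snd (D (0, 1)) - fst (D (0, 1)) * snd (D (1, 0))"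
  shows "d \<noteq> 0"
    and "inv D v = ((snd (D (0, 1)) * fst v - fst (D (0, 1)) * snd v) / d,
                    (fst (D (1, 0)) * snd v - snd (D (1, 0)) * fst v) / d)"
proof -
  have ex: "D (x, y) = (x * fst (D (1, 0)) + y * fst (D (0, 1)), x * snd (D (1, 0)) + y * snd (D (0, 1)))" for x y
    using plane_linear_expand[OF assms(1), of x y] by (simp add: prod_eq_iff)
  show d: "d \<noteq> 0"
  proof
    assume "d = 0"
    \<comment> \<open>Up to sign these are the columns of the adjugate matrix. If
      \<open>d = 0\<close>, both lie in the kernel, and injectivity then makes the first column of
      \<open>D\<close> vanish.\<close>
    then have "D (snd (D (0, 1)), - snd (D (1, 0))) = 0" "D (fst (D (0, 1)), - fst (D (1, 0))) = 0"
      unfolding ex[of _ "- _"] d_def by (auto simp: zero_prod_def algebra_simps)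
    then have "snd (D (1, 0)) = 0" "fst (D (1, 0)) = 0"
      using linear_injective_0[OF assms(1)] assms(2) unfolding zero_prod_def
      by (metis neg_equal_0_iff_equal prod.inject)+
    then have "D (1, 0) = 0" by (simp add: prod_eq_iff)
    then have "(1::real, 0::real) = 0" using linear_injective_0[OF assms(1)] assms(2) by blast
    then show False by (simp add: zero_prod_def)
  qed
  let ?w = "((snd (D (0, 1)) * fst v - fst (D (0, 1)) * snd v) / d,
             (fst (D (1, 0)) * snd v - snd (D (1, 0)) * fst v) / d)"
  have c1: "x / d * p + y / d * q = z" if "x * p + y * q = d * z" for x y p q z
    using that d by (simp add: add_divide_distrib[symmetric])
  have "D ?w = v"
    unfolding ex[of "_ / _"] prod_eq_iff fst_conv snd_conv
    by (intro conjI c1) (simp_all add: d_def algebra_simps)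
  then show "inv D v = ?w" using assms(2) by (metis inv_f_f)
qed

text \<open>The \<open>C^1\<close> theorem gives an inverse \<open>g\<close> with derivative
  \<open>inv (D (g y))\<close>. By Cramer's rule this is a smooth function of \<open>g y\<close>, so
  \<open>g\<close> being \<open>C^k\<close> makes its derivative \<open>C^k\<close> and
  \<open>g\<close> itself \<open>C^(k+1)\<close>.\<close>

lemma smooth_inverse_function_plane:
  fixes f :: "real \<times> real \<Rightarrow> real \<times> real"
  assumes "open U" "Cinf_on U f" "x0 \<in> U" "inj (frechet_derivative f (at x0))"
  obtains U' V g where "open U'" "U' \<subseteq> U" "x0 \<in> U'" "open V" "f x0 \<in> V"
    "homeomorphism U' V f g" "Cinf_on V g"
proof -
  define D where "D = (\<lambda>x. frechet_derivative f (at x))"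
  have D: "(f has_derivative D x) (at x)" if "x \<in> U" for x
    using Cinf_on_has_derivative[OF assms(2) that] by (simp add: D_def)
  have bl: "bounded_linear (D x)" if "x \<in> U" for x
    using D[OF that] has_derivative_bounded_linear by blast
  have app: "blinfun_apply (Blinfun (D x)) = D x" if "x \<in> U" for x
    using bounded_linear_Blinfun_apply[OF bl[OF that]] .
  have Dsm: "Cinf_on U (\<lambda>x. D x v)" for v
    unfolding D_def using Cinf_on_pd[OF assms(2)] .
  have contf: "continuous_on U (\<lambda>x. Blinfun (D x))"
  proof (rule continuous_on_blinfun_componentwise)
    fix i :: "real \<times> real"
    show "continuous_on U (\<lambda>x. blinfun_apply (Blinfun (D x)) i)"
      using Cinf_on_imp_continuous_on[OF Dsm[of i]] app by (simp cong: continuous_on_cong)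
  qed
  have lin0: "linear (D x0)" using bl[OF assms(3)] bounded_linear.linear by blast
  obtain L where L: "linear L" "L \<circ> D x0 = id"
    using linear_injective_left_inverse[OF lin0] assms(4) unfolding D_def by blast
  have invf: "Blinfun L o\<^sub>L Blinfun (D x0) = id_blinfun"
  proof (rule blinfun_eqI)
    fix i
    have "bounded_linear L" using L(1) linear_conv_bounded_linear by blast
    then show "blinfun_apply (Blinfun L o\<^sub>L Blinfun (D x0)) i = blinfun_apply id_blinfun i"
      unfolding blinfun_apply_blinfun_compose app[OF assms(3)] bounded_linear_Blinfun_apply[OF \<open>bounded_linear L\<close>]
      using fun_cong[OF L(2), of i] by simp
  qed
  obtain U' V g g' where r: "open U'" "U' \<subseteq> U" "x0 \<in> U'" "open V" "f x0 \<in> V" "homeomorphism U' V f g"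
    and g: "\<And>y. y \<in> V \<Longrightarrow> (g has_derivative (g' y)) (at y)"
    "\<And>y. y \<in> V \<Longrightarrow> g' y = inv (blinfun_apply (Blinfun (D (g y))))"
    "\<And>y. y \<in> V \<Longrightarrow> bij (blinfun_apply (Blinfun (D (g y))))"
    using inverse_function_theorem[OF assms(1) _ contf assms(3) invf] D app by metis
  have gU: "g y \<in> U'" if "y \<in> V" for y
    using r(6) that by (auto simp: homeomorphism_def)
  have fU: "f x \<in> V" "g (f x) = x" if "x \<in> U'" for x
    using r(6) that by (auto simp: homeomorphism_def)
  have inj: "linear (D x)" "inj (D x)" if "x \<in> U'" for x
  proof -
    have "x \<in> U" using that r(2) by auto
    then show "linear (D x)" "inj (D x)"
      using g(3)[OF fU(1)[OF that]] bounded_linear.linear[OF bl]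
      by (auto simp: fU(2)[OF that] app dest: bij_is_inj)
  qed
  have N: "Cinf_on U' (\<lambda>x. inv (D x) v)" for v
  proof (rule Cinf_on_cong[OF r(1)])
    show "Cinf_on U' (\<lambda>x. ((snd (D x (0, 1)) * fst v - fst (D x (0, 1)) * snd v) /
              (fst (D x (1, 0)) * snd (D x (0, 1)) - fst (D x (0, 1)) * snd (D x (1, 0))),
            (fst (D x (1, 0)) * snd v - snd (D x (1, 0)) * fst v) /
              (fst (D x (1, 0)) * snd (D x (0, 1)) - fst (D x (0, 1)) * snd (D x (1, 0)))))"
      by (intro Cinf_intros r(1) Cinf_on_subset[OF r(2)] Dsm plane_inverse_cramer(1) inj)
        (auto simp: inj)
  qed (use plane_inverse_cramer(2)[OF inj] in auto)
  have "Ck_on k V g" for k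
  proof (induction k)
    case 0
    then show ?case using r(6) by (simp add: homeomorphism_def)
  next
    case (Suc k)
    show ?case
    proof (rule Ck_on_SucI[OF r(4) g(1)])
      fix v
      have "Ck_on k V (\<lambda>y. inv (D (g y)) v)"
        by (rule Ck_on_compose[OF r(4) _ Suc.IH Cinf_on_imp_Ck[OF N]]) (use gU in auto)
      then show "Ck_on k V (\<lambda>y. g' y v)"
      proof (rule Ck_on_cong[OF r(4), rotated])
        fix y assume "y \<in> V"
        then show "inv (D (g y)) v = g' y v"
          using g(2)[of y] app[OF subsetD[OF r(2) gU[of y]]] by metis
      qed
    qed
  qed
  then have "Cinf_on V g" by (simp add: Cinf_on_def)
  with r that show thesis by blast
qed


section \<open>Graphs in the Heisenberg group\<close>

definition hproj :: "heis \<Rightarrow> real \<times> real" where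
  "hproj p = (fst p, fst (snd p))"

definition graph_map :: "(real \<times> real \<Rightarrow> real) \<Rightarrow> real \<times> real \<Rightarrow> heis" where
  "graph_map u q = (fst q, snd q, u q)"

text \<open>All of \<open>M \<inter> V\<close> has to be the graph, so that tangent spaces and
  singular points of \<open>M\<close> inside \<open>V\<close> can be read off from \<open>u\<close>
  alone.\<close>

definition local_graph :: "heis set \<Rightarrow> heis set \<Rightarrow> (real \<times> real) set \<Rightarrow> (real \<times> real \<Rightarrow> real) \<Rightarrow> bool" where
  "local_graph M V Q u \<longleftrightarrow> open V \<and> open Q \<and> Cinf_on Q u \<and> M \<inter> V = graph_map u ` Q"

text \<open>The values of the contact form on the tangent vectors of the graph of \<open>u\<close> over the
  coordinate directions.\<close>

definition contact_x :: "(real \<times> real \<Rightarrow> real) \<Rightarrow> real \<times> real \<Rightarrow> real" where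
  "contact_x u q = pd (1, 0) u q - snd q"

definition contact_y :: "(real \<times> real \<Rightarrow> real) \<Rightarrow> real \<times> real \<Rightarrow> real" where
  "contact_y u q = pd (0, 1) u q + fst q"

lemma hproj_graph_map [simp]: "hproj (graph_map u q) = q"
  by (simp add: hproj_def graph_map_def)

lemma bounded_linear_hproj: "bounded_linear hproj"
  unfolding hproj_def
  by (intro bounded_linear_Pair bounded_linear_fst bounded_linear_fst_comp bounded_linear_snd)

lemma continuous_on_hproj: "continuous_on S hproj"
  by (rule linear_continuous_on[OF bounded_linear_hproj])

lemma open_vimage_hproj: "open Q \<Longrightarrow> open (hproj -` Q)"
  using continuous_on_hproj continuous_on_open_vimage[of UNIV hproj] by auto

lemma local_graphD:
  assumes "local_graph M V Q u"
  shows "open V" "open Q" "Cinf_on Q u" "q \<in> Q \<Longrightarrow> graph_map u q \<in> M" "q \<in> Q \<Longrightarrow> graph_map u q \<in> V"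
    "p \<in> M \<Longrightarrow> p \<in> V \<Longrightarrow> hproj p \<in> Q" "p \<in> M \<Longrightarrow> p \<in> V \<Longrightarrow> graph_map u (hproj p) = p"
proof -
  have eq: "M \<inter> V = graph_map u ` Q" and "open V" "open Q" "Cinf_on Q u"
    using assms unfolding local_graph_def by auto
  then show "open V" "open Q" "Cinf_on Q u" by auto
  have "graph_map u q \<in> M \<inter> V" if "q \<in> Q"
    unfolding eq using that by (rule imageI)
  then show "q \<in> Q \<Longrightarrow> graph_map u q \<in> M" "q \<in> Q \<Longrightarrow> graph_map u q \<in> V" by auto
  have "hproj p \<in> Q \<and> graph_map u (hproj p) = p" if "p \<in> M" "p \<in> V"
  proof -
    have "p \<in> graph_map u ` Q" using that by (simp flip: eq)
    then show ?thesis by auto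
  qed
  then show "p \<in> M \<Longrightarrow> p \<in> V \<Longrightarrow> hproj p \<in> Q" "p \<in> M \<Longrightarrow> p \<in> V \<Longrightarrow> graph_map u (hproj p) = p"
    by blast+
qed

lemma local_graph_restrict:
  assumes "local_graph M V Q u" "open Q'" "Q' \<subseteq> Q"
  shows "local_graph M (V \<inter> hproj -` Q') Q' u"
proof -
  note l = local_graphD[OF assms(1)]
  have "M \<inter> (V \<inter> hproj -` Q') = graph_map u ` Q'"
  proof (intro equalityI subsetI)
    fix p assume "p \<in> M \<inter> (V \<inter> hproj -` Q')"
    then show "p \<in> graph_map u ` Q'" using l(7)[of p] by (intro image_eqI[of _ _ "hproj p"]) auto
  next
    fix p assume "p \<in> graph_map u ` Q'"
    then show "p \<in> M \<inter> (V \<inter> hproj -` Q')" using l(4,5) assms(3) by auto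
  qed
  then show ?thesis unfolding local_graph_def
    using l(1) assms Cinf_on_subset[OF assms(3) l(3)] open_vimage_hproj[OF assms(2)] by auto
qed

section \<open>Tangent vectors and singular points of graphs\<close>

lemma has_vector_derivative_line: "((\<lambda>t. q + t *\<^sub>R v) has_vector_derivative v) (at t)"
  by (auto intro!: derivative_eq_intros simp: has_vector_derivative_def)

lemma has_vector_derivative_fun_compose:
  assumes "(\<gamma> has_vector_derivative v) (at t)" "(f has_derivative D) (at (\<gamma> t))"
  shows "((\<lambda>t. f (\<gamma> t)) has_vector_derivative D v) (at t)"
proof -
  have "((\<lambda>t. f (\<gamma> t)) has_derivative (\<lambda>s. D (s *\<^sub>R v))) (at t)"
    using has_derivative_compose[OF assms(1)[unfolded has_vector_derivative_def] assms(2)] .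
  then show ?thesis
    using linear_scale[OF has_derivative_linear[OF assms(2)]]
    by (simp add: has_vector_derivative_def)
qed

lemma graph_map_has_derivative:
  assumes "(u has_derivative D) (at q)"
  shows "(graph_map u has_derivative (\<lambda>v. (fst v, snd v, D v))) (at q)"
  unfolding graph_map_def using assms
  by (intro has_derivative_Pair has_derivative_fst has_derivative_snd has_derivative_ident)

text \<open>The curves that define tangent vectors are continuous at 0, so they stay in
  \<open>V\<close> for small times.\<close>

lemma tangent_space_open:
  assumes "open V" "p \<in> V"
  shows "tangent_space (M \<inter> V) p = tangent_space M p"
proof -
  have "(\<forall>\<^sub>F t in at 0. \<gamma> t \<in> M \<inter> V) \<longleftrightarrow> (\<forall>\<^sub>F t in at 0. \<gamma> t \<in> M)"
    if "\<gamma> 0 = p" "(\<gamma> has_vector_derivative v) (at 0)" for \<gamma> :: "real \<Rightarrow> heis" and v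
  proof -
    have "isCont \<gamma> 0" using that(2) has_vector_derivative_continuous by blast
    then have "\<forall>\<^sub>F t in at 0. \<gamma> t \<in> V"
      using assms that(1) by (simp add: topological_tendstoD isCont_def)
    then show ?thesis by (auto elim: eventually_elim2)
  qed
  then show ?thesis unfolding tangent_space_def by blast
qed

text \<open>A curve in \<open>M\<close> through the point is, for small times, the lift of its own
  projection, so the projected velocity determines the velocity. Conversely, straight lines in
  \<open>Q\<close> lift to curves in \<open>M\<close>.\<close>

lemma tangent_space_graph:
  assumes "local_graph M V Q u" "q \<in> Q"
  shows "tangent_space M (graph_map u q) = range (\<lambda>v. (fst v, snd v, frechet_derivative u (at q) v))"
proof (intro equalityI subsetI)
  note l = local_graphD[OF assms(1)]
  let ?D = "frechet_derivative u (at q)"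
  have D: "(u has_derivative ?D) (at q)" using Cinf_on_has_derivative[OF l(3) assms(2)] .
  fix w
  assume "w \<in> tangent_space M (graph_map u q)"
  then obtain \<gamma> where g: "\<gamma> 0 = graph_map u q" "\<forall>\<^sub>F t in at 0. \<gamma> t \<in> M"
    "(\<gamma> has_vector_derivative w) (at (0::real))" unfolding tangent_space_def by blast
  have "isCont \<gamma> 0" using g(3) has_vector_derivative_continuous by blast
  then have "\<forall>\<^sub>F t in at 0. \<gamma> t \<in> V"
    using l(1) l(5)[OF assms(2)] g(1) by (simp add: topological_tendstoD isCont_def)
  then have "\<forall>\<^sub>F t in at 0. graph_map u (hproj (\<gamma> t)) = \<gamma> t"
    using g(2) by eventually_elim (use l(7) in auto)
  then have "((\<lambda>t. graph_map u (hproj (\<gamma> t))) has_vector_derivative w) (at 0)"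
    using g(3) g(1) unfolding has_vector_derivative_def
    by (intro has_derivative_transform_eventually[OF g(3)[unfolded has_vector_derivative_def]])
      (auto elim: eventually_mono)
  moreover have "((\<lambda>t. hproj (\<gamma> t)) has_vector_derivative hproj w) (at 0)"
    using bounded_linear.has_vector_derivative[OF bounded_linear_hproj g(3)] .
  then have "((\<lambda>t. graph_map u (hproj (\<gamma> t))) has_vector_derivative
     (fst (hproj w), snd (hproj w), ?D (hproj w))) (at 0)"
    by (rule has_vector_derivative_fun_compose) (use graph_map_has_derivative[OF D] g(1) in simp)
  ultimately have "w = (fst (hproj w), snd (hproj w), ?D (hproj w))"
    using vector_derivative_unique_at by blast
  then show "w \<in> range (\<lambda>v. (fst v, snd v, ?D v))" by (rule range_eqI)
next
  note l = local_graphD[OF assms(1)]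
  let ?D = "frechet_derivative u (at q)"
  have D: "(u has_derivative ?D) (at q)" using Cinf_on_has_derivative[OF l(3) assms(2)] .
  fix w assume "w \<in> range (\<lambda>v. (fst v, snd v, ?D v))"
  then obtain v where w: "w = (fst v, snd v, ?D v)" by blast
  let ?g = "\<lambda>t. graph_map u (q + t *\<^sub>R v)"
  have "(?g has_vector_derivative w) (at 0)"
    unfolding w by (rule has_vector_derivative_fun_compose[OF has_vector_derivative_line])
      (use graph_map_has_derivative[OF D] in simp)
  moreover have "\<forall>\<^sub>F t in at 0. q + t *\<^sub>R v \<in> Q"
  proof -
    have "((\<lambda>t. q + t *\<^sub>R v) \<longlongrightarrow> q + 0 *\<^sub>R v) (at 0)" by (intro tendsto_intros)
    then show ?thesis using l(2) assms(2) by (intro topological_tendstoD[where l = q]) auto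
  qed
  then have "\<forall>\<^sub>F t in at 0. ?g t \<in> M" by eventually_elim (rule l(4))
  ultimately show "w \<in> tangent_space M (graph_map u q)"
    unfolding tangent_space_def by (intro CollectI exI[of _ ?g]) simp
qed

lemma contact_form_graph:
  assumes "Cinf_on Q u" "q \<in> Q"
  shows "contact_form (graph_map u q) (fst v, snd v, frechet_derivative u (at q) v)
    = fst v * contact_x u q + snd v * contact_y u q"
proof -
  have lin: "linear (frechet_derivative u (at q))"
    using has_derivative_linear[OF Cinf_on_has_derivative[OF assms]] .
  show ?thesis
    using plane_linear_expand[OF lin, of "fst v" "snd v"]
    by (simp add: graph_map_def contact_x_def contact_y_def algebra_simps)
qed

text \<open>The contact form has coefficient 1 on \<open>dz\<close>, so a contact vector is
  determined by its projection, just as a tangent vector of the graph is. Once the form vanishes on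
  the tangent plane, the two planes are therefore equal.\<close>

lemma singular_graph_iff:
  assumes "local_graph M V Q u" "q \<in> Q"
  shows "graph_map u q \<in> singular_set M \<longleftrightarrow> contact_x u q = 0 \<and> contact_y u q = 0"
proof -
  note l = local_graphD[OF assms(1)]
  let ?D = "frechet_derivative u (at q)"
  note c = contact_form_graph[OF l(3) assms(2)]
  have "tangent_space M (graph_map u q) = contact_plane (graph_map u q) \<longleftrightarrow>
    contact_x u q = 0 \<and> contact_y u q = 0"
  proof
    assume "tangent_space M (graph_map u q) = contact_plane (graph_map u q)"
    then have "(fst v, snd v, ?D v) \<in> contact_plane (graph_map u q)" for v
      using tangent_space_graph[OF assms] by blast
    then have "fst v * contact_x u q + snd v * contact_y u q = 0" for v
      unfolding contact_plane_def using c by simp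
    from this[of "(1, 0)"] this[of "(0, 1)"] show "contact_x u q = 0 \<and> contact_y u q = 0" by simp
  next
    assume 0: "contact_x u q = 0 \<and> contact_y u q = 0"
    show "tangent_space M (graph_map u q) = contact_plane (graph_map u q)"
    proof (intro equalityI subsetI)
      fix w assume "w \<in> tangent_space M (graph_map u q)"
      then show "w \<in> contact_plane (graph_map u q)"
        unfolding tangent_space_graph[OF assms] contact_plane_def using c 0 by auto
    next
      fix w assume w: "w \<in> contact_plane (graph_map u q)"
      have "contact_form (graph_map u q) (fst (hproj w), snd (hproj w), ?D (hproj w)) = 0"
        unfolding c using 0 by simp
      then have "w = (fst (hproj w), snd (hproj w), ?D (hproj w))"
        using w by (cases w) (simp add: contact_plane_def graph_map_def hproj_def)
      then show "w \<in> tangent_space M (graph_map u q)"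
        unfolding tangent_space_graph[OF assms] by (rule range_eqI)
    qed
  qed
  then show ?thesis using l(4)[OF assms(2)] by (simp add: singular_set_def)
qed

lemma Cinf_on_contact:
  assumes "open Q" "Cinf_on Q u"
  shows "Cinf_on Q (contact_x u)" "Cinf_on Q (contact_y u)"
proof -
  show "Cinf_on Q (contact_x u)" unfolding contact_x_def by (intro Cinf_intros assms)
  show "Cinf_on Q (contact_y u)" unfolding contact_y_def by (intro Cinf_intros assms)
qed

section \<open>Derivatives on the surface and the equation of a p-minimal graph\<close>

text \<open>Differentiating within \<open>M\<close> determines the derivative only on tangent vectors.\<close>

lemma dir_deriv_eq:
  assumes "(f has_derivative D) (at p within M)" "w \<in> tangent_space M p" "p \<in> M"
  shows "dir_deriv M f p w = D w"
proof -
  let ?D = "frechet_derivative f (at p within M)"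
  have D': "(f has_derivative ?D) (at p within M)"
    using assms(1) differentiable_def frechet_derivative_works by blast
  obtain \<gamma> where g: "\<gamma> 0 = p" "\<forall>\<^sub>F t in at 0. \<gamma> t \<in> M" "(\<gamma> has_vector_derivative w) (at (0::real))"
    using assms(2) unfolding tangent_space_def by blast
  obtain S where S: "open S" "0 \<in> S" "\<And>t. t \<in> S \<Longrightarrow> t \<noteq> 0 \<Longrightarrow> \<gamma> t \<in> M"
    using g(2) unfolding eventually_at_topological by blast
  have sub: "\<gamma> ` S \<subseteq> M" using S(3) g(1) assms(3) by (metis image_subsetI)
  \<comment> \<open>Along a curve in \<open>M\<close> with velocity \<open>w\<close>, every
    candidate derivative pulls back to the derivative of one function of a real variable; so all
    candidates agree on \<open>w\<close>.\<close>
  have comp: "((\<lambda>t. f (\<gamma> t)) has_derivative (\<lambda>s. E (s *\<^sub>R w))) (at 0)"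
    if "(f has_derivative E) (at p within M)" for E
  proof -
    have "(\<gamma> has_derivative (\<lambda>s. s *\<^sub>R w)) (at 0 within S)"
      using g(3) unfolding has_vector_derivative_def by (rule has_derivative_at_withinI)
    moreover have "(f has_derivative E) (at (\<gamma> 0) within \<gamma> ` S)"
      unfolding g(1) by (rule has_derivative_subset[OF that sub])
    ultimately have "((\<lambda>t. f (\<gamma> t)) has_derivative (\<lambda>s. E (s *\<^sub>R w))) (at 0 within S)"
      by (rule has_derivative_in_compose)
    then show ?thesis using at_within_open[OF S(2,1)] by simp
  qed
  have "(\<lambda>s. ?D (s *\<^sub>R w)) = (\<lambda>s. D (s *\<^sub>R w))"
    using has_derivative_unique[OF comp[OF D'] comp[OF assms(1)]] .
  from fun_cong[OF this, of 1] show ?thesis by (simp add: dir_deriv_def)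
qed

text \<open>Where \<open>(F, G)\<close> is nonzero, the lift of \<open>(G, - F) / N\<close> with
  \<open>N\<close> its length is a choice of \<open>e_1\<close>, and \<open>J e_1\<close> then has
  the coefficients \<open>F / N\<close> and \<open>G / N\<close> in the left invariant frame.
  Curvature 0 says that both are stationary along \<open>e_1\<close>. Clearing \<open>N\<close>
  leaves an identity that holds trivially at singular points too.\<close>

lemma p_minimal_graph_equation:
  assumes "p_minimal M" "local_graph M V Q u" "q \<in> Q"
  defines "F \<equiv> contact_x u" and "G \<equiv> contact_y u"
  shows "F q * frechet_derivative G (at q) (G q, - F q) = G q * frechet_derivative F (at q) (G q, - F q)"
proof (cases "F q = 0 \<and> G q = 0")
  case True
  then show ?thesis by simp
next
  case False
  note l = local_graphD[OF assms(2)]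
  have FG: "Cinf_on Q F" "Cinf_on Q G"
    unfolding F_def G_def using Cinf_on_contact[OF l(2,3)] .
  define Q' where "Q' = {q \<in> Q. 0 < (F q)\<^sup>2 + (G q)\<^sup>2}"
  have Q': "open Q'" "Q' \<subseteq> Q"
  proof -
    have "Q' = Q \<inter> (\<lambda>q. (F q)\<^sup>2 + (G q)\<^sup>2) -` {0<..}" by (auto simp: Q'_def)
    moreover have "continuous_on Q (\<lambda>q. (F q)\<^sup>2 + (G q)\<^sup>2)"
      using FG[THEN Cinf_on_imp_continuous_on] by (intro continuous_intros)
    ultimately show "open Q'" using continuous_open_preimage[OF _ l(2)] by (metis open_greaterThan)
  qed (auto simp: Q'_def)
  have q: "q \<in> Q'" using False assms(3)
    by (auto simp: Q'_def sum_power2_gt_zero_iff)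
  have FG': "Cinf_on Q' F" "Cinf_on Q' G" using FG Cinf_on_subset[OF Q'(2)] by auto
  define N where "N = (\<lambda>q. sqrt (F q * F q + G q * G q))"
  have Npos: "N q > 0" if "q \<in> Q'" for q using that by (simp add: N_def Q'_def power2_eq_square)
  have N: "Cinf_on Q' N" unfolding N_def
    by (intro Cinf_intros Q'(1) FG') (simp add: Q'_def power2_eq_square)
  define f where "f = (\<lambda>q. F q / N q)"
  define g where "g = (\<lambda>q. G q / N q)"
  have fg: "Cinf_on Q' f" "Cinf_on Q' g"
    unfolding f_def g_def using less_imp_neq[OF Npos, symmetric]
    by (auto intro: Cinf_on_divide[OF Q'(1) _ N] FG')
  have fg1: "f q * f q + g q * g q = 1" if "q \<in> Q'" for q
  proof -
    have N2: "N q * N q = F q * F q + G q * G q" by (simp add: N_def)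
    have "f q * f q + g q * g q = (F q * F q + G q * G q) / (N q * N q)"
      by (simp add: f_def g_def add_divide_distrib)
    also have "\<dots> = 1" unfolding N2[symmetric] using Npos[OF that] by simp
    finally show ?thesis .
  qed
  define E where "E = (\<lambda>q. (g q, - f q, g q * pd (1, 0) u q + - f q * pd (0, 1) u q))"
  have E: "Cinf_on Q' E" unfolding E_def
    by (intro Cinf_intros Q'(1) fg Cinf_on_subset[OF Q'(2) l(3)])
  have E_tan: "E q = (fst (g q, - f q), snd (g q, - f q), frechet_derivative u (at q) (g q, - f q))" if "q \<in> Q'" for q
    using plane_linear_expand[OF has_derivative_linear[OF Cinf_on_has_derivative[OF l(3)]], of q "g q" "- f q"]
      that Q'(2) by (auto simp: E_def)
  define e where "e = (\<lambda>p. E (hproj p))"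
  define A where "A = graph_map u ` Q'"
  have lg': "local_graph M (V \<inter> hproj -` Q') Q' u" using local_graph_restrict[OF assms(2) Q'] .
  have "char_field M A e"
    unfolding char_field_def
  proof (intro conjI ballI)
    show "openin (top_of_set M) A"
      using lg' unfolding local_graph_def A_def by (metis openin_open)
    show "A \<subseteq> regular_part M"
    proof
      fix p assume "p \<in> A"
      then obtain q where q: "q \<in> Q'" "p = graph_map u q" unfolding A_def by blast
      then show "p \<in> regular_part M"
        using singular_graph_iff[OF lg' q(1)] local_graphD(4)[OF lg' q(1)]
        by (auto simp: regular_part_def Q'_def F_def G_def)
    qed
    show "Cinf_along A e"
      unfolding Cinf_along_def
    proof (intro ballI exI conjI)
      show "open (hproj -` Q')" using open_vimage_hproj[OF Q'(1)] .
      then show "Cinf_on (hproj -` Q') e" unfolding e_def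
        by (intro Cinf_on_compose[OF _ _ _ E] Cinf_on_bounded_linear[OF _ bounded_linear_hproj]) auto
    qed (auto simp: A_def)
    fix p assume "p \<in> A"
    then obtain q where q: "q \<in> Q'" "p = graph_map u q" unfolding A_def by blast
    have ep: "e p = E q" by (simp add: e_def q)
    have cf: "contact_form p (E q) = 0"
      unfolding E_tan[OF q(1)] q(2) contact_form_graph[OF local_graphD(3)[OF lg'] q(1)]
      by (simp add: f_def g_def F_def G_def)
    have tan: "E q \<in> tangent_space M p"
      unfolding q(2) tangent_space_graph[OF lg' q(1)] E_tan[OF q(1)] by (rule range_eqI, rule refl)
    show "e p \<in> tangent_space M p \<inter> contact_plane p"
      using cf tan by (simp add: ep contact_plane_def)
    show "hmetric p (e p) (e p) = 1"
      using fg1[OF q(1)] cf by (simp add: ep hmetric_def) (simp add: E_def algebra_simps)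
  qed
  moreover define p where "p = graph_map u q"
  have pA: "p \<in> A" using q by (simp add: A_def p_def)
  ultimately have H: "hnabla M p (e p) (\<lambda>q. hJ q (e q)) = 0"
    using assms(1) by (auto simp: p_minimal_def has_p_mean_curvature_def)
  have tan: "e p \<in> tangent_space M p"
    unfolding p_def tangent_space_graph[OF lg' q] e_def hproj_graph_map E_tan[OF q] by (rule range_eqI, rule refl)
  have pM: "p \<in> M" using l(4) assms(3) by (simp add: p_def)
  \<comment> \<open>Functions of the base point extend to the ambient space through
    \<open>hproj\<close>, so \<open>dir_deriv_eq\<close> replaces the derivative within
    \<open>M\<close> by an ordinary one.\<close>
  have dd: "dir_deriv M (\<lambda>p. h (hproj p)) p (e p) = frechet_derivative h (at q) (g q, - f q)" if "Cinf_on Q' h" for h :: "real \<times> real \<Rightarrow> real"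
  proof -
    have "((\<lambda>p. h (hproj p)) has_derivative (\<lambda>v. frechet_derivative h (at q) (hproj v))) (at p)"
      by (rule has_derivative_compose[OF bounded_linear_imp_has_derivative[OF bounded_linear_hproj]])
        (use Cinf_on_has_derivative[OF that q] in \<open>simp add: p_def\<close>)
    from dir_deriv_eq[OF has_derivative_at_withinI[OF this] tan pM]
    show ?thesis by (simp add: e_def p_def E_def hproj_def graph_map_def)
  qed
  have J: "fst (hJ p (e p)) = f (hproj p)" "fst (snd (hJ p (e p))) = g (hproj p)" for p
    by (cases p; simp add: hJ_def e_def E_def)+
  have f0: "frechet_derivative f (at q) (g q, - f q) = 0" and g0: "frechet_derivative g (at q) (g q, - f q) = 0"
    using H unfolding hnabla_def J dd[OF fg(1)] dd[OF fg(2)]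
    by (cases p; simp add: hT_def zero_prod_def)+
  \<comment> \<open>Product rule for \<open>K = N k\<close> with \<open>k\<close> stationary along
    \<open>e_1\<close>: only the derivative of \<open>N\<close> survives. \<open>F\<close> and
    \<open>G\<close> thus change by a common factor times \<open>f\<close> and \<open>g\<close>,
    that is, in proportion to themselves.\<close>
  have key: "frechet_derivative K (at q) (G q, - F q) = N q * frechet_derivative N (at q) (g q, - f q) * k q"
    if k: "Cinf_on Q' k" "frechet_derivative k (at q) (g q, - f q) = 0" "\<And>q. q \<in> Q' \<Longrightarrow> K q = N q * k q" for K k
  proof -
    have "((\<lambda>q. N q * k q) has_derivative (\<lambda>v. N q * frechet_derivative k (at q) v + frechet_derivative N (at q) v * k q)) (at q)"
      by (intro has_derivative_mult Cinf_on_has_derivative[OF N q] Cinf_on_has_derivative[OF k(1) q])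
    then have K: "(K has_derivative (\<lambda>v. N q * frechet_derivative k (at q) v + frechet_derivative N (at q) v * k q)) (at q)"
      by (rule has_derivative_transform_within_open[OF _ Q'(1) q]) (simp add: k(3))
    have "(G q, - F q) = N q *\<^sub>R (g q, - f q)" using Npos[OF q] by (simp add: f_def g_def)
    then have "frechet_derivative K (at q) (G q, - F q) = N q * frechet_derivative K (at q) (g q, - f q)"
      unfolding frechet_derivative_at[OF K, symmetric]
      by (simp only: linear_scale[OF has_derivative_linear[OF K]] real_scaleR_def)
    also have "frechet_derivative K (at q) (g q, - f q) = frechet_derivative N (at q) (g q, - f q) * k q"
      unfolding frechet_derivative_at[OF K, symmetric] using k(2) by simp
    finally show ?thesis by simp
  qed
  have ne: "N q \<noteq> 0" if "q \<in> Q'" for q using Npos[OF that] by simp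
  have "frechet_derivative F (at q) (G q, - F q) = N q * frechet_derivative N (at q) (g q, - f q) * f q"
    by (rule key[OF fg(1) f0]) (simp add: f_def ne)
  moreover have "frechet_derivative G (at q) (G q, - F q) = N q * frechet_derivative N (at q) (g q, - f q) * g q"
    by (rule key[OF fg(2) g0]) (simp add: g_def ne)
  ultimately show ?thesis by (simp only:) (simp add: f_def g_def)
qed

text \<open>A contact plane contains no nonzero vertical vector. At a singular point the tangent
  plane is such a plane, so projecting a parametrization to the first two coordinates keeps its
  derivative injective, and the projection can be inverted locally.\<close>

lemma singular_point_local_graph:
  assumes "smooth_surface M" "p \<in> singular_set M"
  obtains V Q u where "local_graph M V Q u" "p \<in> V"
proof -
  have pM: "p \<in> M" and tan: "tangent_space M p = contact_plane p"
    using assms(2) by (auto simp: singular_set_def)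
  obtain W \<phi> w0 where W: "local_param M W \<phi>" "w0 \<in> W" "p = \<phi> w0"
    using assms(1) pM unfolding smooth_surface_def by blast
  then obtain \<psi> where w: "open W" "Cinf_on W \<phi>" "inj (frechet_derivative \<phi> (at w0))"
    "openin (top_of_set M) (\<phi> ` W)" "homeomorphism W (\<phi> ` W) \<phi> \<psi>"
    unfolding local_param_def by blast
  let ?D = "frechet_derivative \<phi> (at w0)"
  have D: "(\<phi> has_derivative ?D) (at w0)" using Cinf_on_has_derivative[OF w(2) W(2)] .
  have range_tan: "?D v \<in> contact_plane p" for v
  proof -
    have "((\<lambda>t. \<phi> (w0 + t *\<^sub>R v)) has_vector_derivative ?D v) (at 0)"
      by (rule has_vector_derivative_fun_compose[OF has_vector_derivative_line]) (use D in simp)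
    moreover have "((\<lambda>t. w0 + t *\<^sub>R v) \<longlongrightarrow> w0 + 0 *\<^sub>R v) (at 0)" by (intro tendsto_intros)
    then have "\<forall>\<^sub>F t in at 0. w0 + t *\<^sub>R v \<in> W"
      using w(1) W(2) by (intro topological_tendstoD[where l = w0]) auto
    then have "\<forall>\<^sub>F t in at 0. \<phi> (w0 + t *\<^sub>R v) \<in> M"
      by eventually_elim (use openin_imp_subset[OF w(4)] in auto)
    ultimately have "?D v \<in> tangent_space M p"
      unfolding tangent_space_def using W(3) by (intro CollectI exI[of _ "\<lambda>t. \<phi> (w0 + t *\<^sub>R v)"]) simp
    then show ?thesis using tan by simp
  qed
  let ?f = "\<lambda>x. hproj (\<phi> x)"
  have f: "Cinf_on W ?f" by (rule Cinf_on_linear[OF w(1) bounded_linear_hproj w(2)])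
  have "(?f has_derivative (\<lambda>v. hproj (?D v))) (at w0)"
    using bounded_linear.has_derivative[OF bounded_linear_hproj D] .
  then have fD: "frechet_derivative ?f (at w0) = (\<lambda>v. hproj (?D v))"
    by (rule frechet_derivative_at[symmetric])
  have lin: "linear ?D" using has_derivative_linear[OF D] .
  have "inj (\<lambda>v. hproj (?D v))"
  proof -
    have "linear (\<lambda>v. hproj (?D v))"
      using linear_compose[OF lin bounded_linear.linear[OF bounded_linear_hproj]] by (simp add: o_def)
    moreover have "v = 0" if "hproj (?D v) = 0" for v
    proof -
      have "?D v = 0" using that range_tan[of v]
        by (cases "?D v"; cases p) (simp add: hproj_def contact_plane_def zero_prod_def)
      then show ?thesis using w(3) linear_injective_0[OF lin] by blast
    qed
    ultimately show ?thesis using linear_injective_0 by blast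
  qed
  then obtain W' Q g where g: "open W'" "W' \<subseteq> W" "w0 \<in> W'" "open Q" "?f w0 \<in> Q"
    "homeomorphism W' Q ?f g" "Cinf_on Q g"
    using smooth_inverse_function_plane[OF w(1) f W(2)] unfolding fD by metis
  define u where "u = (\<lambda>q. snd (snd (\<phi> (g q))))"
  have "openin (top_of_set (\<phi> ` W)) (\<phi> ` W')"
    using homeomorphism_imp_open_map[OF w(5)] g(1,2) w(1) by (simp add: openin_open_eq)
  then have "openin (top_of_set M) (\<phi> ` W')" using w(4) openin_trans by blast
  then obtain V where V: "open V" "\<phi> ` W' = M \<inter> V" by (auto simp: openin_open)
  have gf: "g (?f x) = x" "?f x \<in> Q" if "x \<in> W'" for x
    using g(6) that by (auto simp: homeomorphism_def)
  have fg: "?f (g y) = y" "g y \<in> W'" if "y \<in> Q" for y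
    using g(6) that by (auto simp: homeomorphism_def)
  have gm: "graph_map u y = \<phi> (g y)" if "y \<in> Q" for y
    using fg(1)[OF that] by (cases "\<phi> (g y)") (auto simp: graph_map_def u_def hproj_def)
  have "graph_map u ` Q = \<phi> ` W'"
  proof (intro equalityI subsetI)
    fix x assume "x \<in> \<phi> ` W'"
    then obtain z where z: "z \<in> W'" "x = \<phi> z" by blast
    then show "x \<in> graph_map u ` Q" using gm[OF gf(2)] gf by (intro image_eqI[of _ _ "?f z"]) auto
  qed (use gm fg in auto)
  moreover have "Cinf_on Q u" unfolding u_def
    by (intro Cinf_on_snd g(4) Cinf_on_compose[OF g(4) _ g(7) w(2)]) (use fg g(2) in auto)
  ultimately have "local_graph M V Q u" using V g(4) by (simp add: local_graph_def)
  moreover have "p \<in> V" using V(2) W(3) g(3) by blast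
  ultimately show thesis using that by blast
qed

text \<open>A characteristic field on a piece of \<open>M \<inter> V\<close> is one on a piece of
  \<open>M\<close>, as tangent spaces agree; and the filters \<open>at p within M \<inter> V\<close>
  and \<open>at p within M\<close> coincide, so the curvature is the same.\<close>

lemma p_minimal_open_subset:
  assumes "p_minimal M" "open V"
  shows "p_minimal (M \<inter> V)"
  unfolding p_minimal_def
proof (intro conjI allI impI ballI)
  have sm: "smooth_surface M" using assms(1) by (simp add: p_minimal_def)
  show "smooth_surface (M \<inter> V)"
    unfolding smooth_surface_def
  proof
    fix p assume p: "p \<in> M \<inter> V"
    then obtain W \<phi> w0 where W: "local_param M W \<phi>" "w0 \<in> W" "p = \<phi> w0"
      using sm unfolding smooth_surface_def by blast
    then obtain \<psi> where w: "open W" "Cinf_on W \<phi>" "\<forall>w\<in>W. inj (frechet_derivative \<phi> (at w))"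
      "openin (top_of_set M) (\<phi> ` W)" "homeomorphism W (\<phi> ` W) \<phi> \<psi>"
      unfolding local_param_def by blast
    let ?W = "W \<inter> \<phi> -` V"
    have o: "open ?W"
      using continuous_open_preimage[OF Cinf_on_imp_continuous_on[OF w(2)] w(1) assms(2)] .
    have im: "\<phi> ` ?W = \<phi> ` W \<inter> V" by auto
    have "local_param (M \<inter> V) ?W \<phi>"
      unfolding local_param_def
    proof (intro conjI)
      show "Cinf_on ?W \<phi>" by (rule Cinf_on_subset[OF _ w(2)]) auto
      show "openin (top_of_set (M \<inter> V)) (\<phi> ` ?W)"
        unfolding im using w(4) by (auto simp: openin_open)
      show "\<exists>\<psi>. homeomorphism ?W (\<phi> ` ?W) \<phi> \<psi>"
        using homeomorphism_of_subsets[OF w(5), of ?W] by blast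
    qed (use o w(3) in auto)
    then show "\<exists>W \<phi>. local_param (M \<inter> V) W \<phi> \<and> p \<in> \<phi> ` W"
      using W p by blast
  qed
  fix A e p assume A: "char_field (M \<inter> V) A e" and p: "p \<in> A"
  have AV: "A \<subseteq> M \<inter> V" using A openin_imp_subset unfolding char_field_def by blast
  have ts: "tangent_space (M \<inter> V) q = tangent_space M q" if "q \<in> V" for q
    using tangent_space_open[OF assms(2) that] .
  have "char_field M A e"
    unfolding char_field_def
  proof (intro conjI)
    have "openin (top_of_set M) (M \<inter> V)" using assms(2) by auto
    then show "openin (top_of_set M) A"
      using A openin_trans unfolding char_field_def by blast
    show "A \<subseteq> regular_part M"
      using A AV ts unfolding char_field_def regular_part_def singular_set_def by blast
    show "\<forall>q\<in>A. e q \<in> tangent_space M q \<inter> contact_plane q \<and> hmetric q (e q) (e q) = 1"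
      using A AV ts unfolding char_field_def by blast
  qed (use A in \<open>simp add: char_field_def\<close>)
  then have "has_p_mean_curvature M e p 0" using assms(1) p unfolding p_minimal_def by blast
  moreover have "at p within M \<inter> V = at p within M"
    using at_within_nhd[of p V "M \<inter> V" M] assms(2) AV p by auto
  ultimately show "has_p_mean_curvature (M \<inter> V) e p 0"
    by (simp add: has_p_mean_curvature_def hnabla_def dir_deriv_def)
qed


section \<open>Degenerate singular points\<close>

text \<open>The mixed second derivatives of \<open>u\<close> cancel. The 2 comes from the terms
  \<open>- y\<close> and \<open>x\<close>; it is the coefficient in
  \<open>d Theta = 2 dx dy\<close>.\<close>

lemma contact_curl:
  assumes "open Q" "Cinf_on Q u" "q \<in> Q"
  shows "pd (1, 0) (contact_y u) q - pd (0, 1) (contact_x u) q = 2"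
proof -
  have "(contact_y u has_derivative (\<lambda>v. frechet_derivative (pd (0, 1) u) (at q) v + fst v)) (at q)"
    unfolding contact_y_def
    by (intro has_derivative_add has_derivative_fst has_derivative_ident
        Cinf_on_has_derivative[OF Cinf_on_pd[OF assms(2)] assms(3)])
  moreover have "(contact_x u has_derivative (\<lambda>v. frechet_derivative (pd (1, 0) u) (at q) v - snd v)) (at q)"
    unfolding contact_x_def
    by (intro has_derivative_diff has_derivative_snd has_derivative_ident
        Cinf_on_has_derivative[OF Cinf_on_pd[OF assms(2)] assms(3)])
  ultimately show ?thesis
    using pd_commute[OF assms, of "(1, 0)" "(0, 1)"] by (simp flip: frechet_derivative_at)
qed

text \<open>In the frame rotated so that \<open>n\<close> spans the cokernel of the derivative of the contact
  coefficients, the equation of the surface forces both coefficients to vanish where one of them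
  does: otherwise differentiating the equation along \<open>n\<close> gives \<open>4 = 0\<close> in the limit.\<close>

lemma degenerate_point_coefficients:
  fixes n1 n2 :: real and u :: "real \<times> real \<Rightarrow> real"
  assumes "p_minimal M" "local_graph M V Q u" "q0 \<in> Q"
    and "contact_x u q0 = 0" "contact_y u q0 = 0" "n1\<^sup>2 + n2\<^sup>2 = 1"
    and deg: "\<And>v. n1 * frechet_derivative (contact_x u) (at q0) v
       + n2 * frechet_derivative (contact_y u) (at q0) v = 0"
  defines "B \<equiv> \<lambda>q. - n2 * contact_x u q + n1 * contact_y u q"
  obtains P where "open P" "q0 \<in> P" "P \<subseteq> Q" "Cinf_on Q B" "pd (n1, n2) B q0 = 2"
    "\<And>q. q \<in> P \<Longrightarrow> B q = 0 \<longleftrightarrow> contact_x u q = 0 \<and> contact_y u q = 0"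
proof -
  note l = local_graphD[OF assms(2)]
  define F where "F = contact_x u"
  define G where "G = contact_y u"
  define A where "A = (\<lambda>q. n1 * F q + n2 * G q)"
  have FG: "Cinf_on Q F" "Cinf_on Q G"
    using Cinf_on_contact[OF l(2,3)] by (simp_all add: F_def G_def)
  have A: "Cinf_on Q A" unfolding A_def by (intro Cinf_intros l(2) FG)
  have B: "Cinf_on Q B" unfolding B_def F_def[symmetric] G_def[symmetric] by (intro Cinf_intros l(2) FG)
  have DA: "frechet_derivative A (at q) v = n1 * frechet_derivative F (at q) v + n2 * frechet_derivative G (at q) v"
    if "q \<in> Q" for q v
  proof -
    have "(A has_derivative (\<lambda>v. n1 * frechet_derivative F (at q) v + n2 * frechet_derivative G (at q) v)) (at q)"
      unfolding A_def by (intro has_derivative_add has_derivative_mult_right Cinf_on_has_derivative[OF _ that] FG)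
    then show ?thesis by (simp flip: frechet_derivative_at)
  qed
  have DB: "frechet_derivative B (at q) v = - n2 * frechet_derivative F (at q) v + n1 * frechet_derivative G (at q) v"
    if "q \<in> Q" for q v
  proof -
    have "(B has_derivative (\<lambda>v. - n2 * frechet_derivative F (at q) v + n1 * frechet_derivative G (at q) v)) (at q)"
      unfolding B_def F_def[symmetric] G_def[symmetric]
      by (intro has_derivative_add has_derivative_mult_right Cinf_on_has_derivative[OF _ that] FG)
    then show ?thesis by (simp flip: frechet_derivative_at)
  qed
  let ?n = "(n1, n2)" and ?m = "(- n2, n1)"
  define a b c d where "a = pd ?n A" and "b = pd ?m A" and "c = pd ?n B" and "d = pd ?m B"
  have abcd: "Cinf_on Q a" "Cinf_on Q b" "Cinf_on Q c" "Cinf_on Q d"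
    unfolding a_def b_def c_def d_def by (intro Cinf_on_pd A B)+
  \<comment> \<open>\<open>(G, - F)\<close> is \<open>(F, G)\<close> turned clockwise by a right
    angle. This turn sends \<open>n\<close> to \<open>- m\<close> and \<open>m\<close> to
    \<open>n\<close>, so \<open>A n + B m\<close> becomes \<open>B n - A m\<close>.\<close>
  have frame: "D (G q, - F q) = B q * D ?n - A q * D ?m" if "linear D" for D :: "real \<times> real \<Rightarrow> real" and q
  proof -
    have "(G q, - F q) = B q *\<^sub>R ?n - A q *\<^sub>R ?m"
    proof -
      have "B q * n1 + A q * n2 = G q * (n1\<^sup>2 + n2\<^sup>2)" "B q * n2 - A q * n1 = - F q * (n1\<^sup>2 + n2\<^sup>2)"
        by (simp_all add: A_def B_def F_def G_def algebra_simps power2_eq_square)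
      then show ?thesis using assms(6) by simp
    qed
    then show ?thesis
      by (simp only: linear_diff[OF that] linear_scale[OF that] real_scaleR_def)
  qed
  have lin: "linear (frechet_derivative h (at q))" if "Cinf_on Q h" "q \<in> Q" for h :: "real \<times> real \<Rightarrow> real" and q
    using has_derivative_linear[OF Cinf_on_has_derivative[OF that]] .
  \<comment> \<open>That two plane vectors are parallel does not depend on the orthonormal frame, so
    the equation keeps its shape for \<open>(A, B)\<close>.\<close>
  have pde: "A q * (B q * c q - A q * d q) - B q * (B q * a q - A q * b q) = 0" if "q \<in> Q" for q
  proof -
    let ?X = "frechet_derivative F (at q) (G q, - F q)" and ?Y = "frechet_derivative G (at q) (G q, - F q)"
    have "F q * ?Y = G q * ?X"
      using p_minimal_graph_equation[OF assms(1,2) that] by (simp add: F_def G_def)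
    then have "(n1\<^sup>2 + n2\<^sup>2) * (F q * ?Y - G q * ?X) = 0" by simp
    then have "A q * frechet_derivative B (at q) (G q, - F q) = B q * frechet_derivative A (at q) (G q, - F q)"
      unfolding DA[OF that] DB[OF that]
      by (simp add: A_def B_def F_def[symmetric] G_def[symmetric] algebra_simps power2_eq_square)
    then show ?thesis
      unfolding frame[OF lin[OF A that]] frame[OF lin[OF B that]] by (simp add: a_def b_def c_def d_def)
  qed
  \<comment> \<open>The curl is rotation invariant as well. Since \<open>b q0 = 0\<close> by the
    choice of \<open>n\<close>, it yields \<open>c q0 = 2\<close>.\<close>
  have curl: "c q - b q = 2" if "q \<in> Q" for q
  proof -
    have e: "frechet_derivative H (at q) (x, y) = x * pd (1, 0) H q + y * pd (0, 1) H q" if "Cinf_on Q H" for H :: "real \<times> real \<Rightarrow> real" and x y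
      using plane_linear_expand[OF lin[OF that \<open>q \<in> Q\<close>], of x y] by simp
    have "c q - b q = (n1\<^sup>2 + n2\<^sup>2) * (pd (1, 0) G q - pd (0, 1) F q)"
      unfolding c_def b_def DA[OF that] DB[OF that] e[OF FG(1), of n1] e[OF FG(1), of "- n2"]
        e[OF FG(2), of n1] e[OF FG(2), of "- n2"]
      by (simp add: algebra_simps power2_eq_square)
    then show ?thesis using contact_curl[OF l(2,3) that] assms(6) by (simp add: F_def G_def)
  qed
  have b0: "b q0 = 0" using DA[OF assms(3)] deg by (simp add: b_def F_def G_def)
  then have c0: "c q0 = 2" using curl[OF assms(3)] by simp
  have A0: "A q0 = 0" using assms(4,5) by (simp add: A_def F_def G_def)
  \<comment> \<open>This is what remains of the equation after differentiating it along
    \<open>n\<close> at a zero of \<open>B\<close> and dividing by \<open>A\<close>. At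
    \<open>q0\<close> its value is \<open>2 * (0 + 2) - 0 = 4\<close>, so it stays positive
    nearby.\<close>
  define h where "h = (\<lambda>q. c q * (b q + c q) - A q * pd ?n d q)"
  have "Cinf_on Q h" unfolding h_def by (intro Cinf_intros l(2) abcd A)
  define P where "P = Q \<inter> h -` {0<..}"
  have "open P" unfolding P_def
    by (rule continuous_open_preimage[OF Cinf_on_imp_continuous_on[OF \<open>Cinf_on Q h\<close>] l(2)]) simp
  moreover have "q0 \<in> P" using assms(3) b0 c0 A0 by (simp add: P_def h_def)
  moreover have "P \<subseteq> Q" by (auto simp: P_def)
  moreover have "B q = 0 \<longleftrightarrow> F q = 0 \<and> G q = 0" if qP: "q \<in> P" for q
  proof
    have q: "q \<in> Q" "h q > 0" using qP by (auto simp: P_def)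
    assume B0: "B q = 0"
    have "A q = 0"
    proof (rule ccontr)
      assume An: "A q \<noteq> 0"
      \<comment> \<open>At a zero of \<open>B\<close> the equation reduces to
        \<open>A^2 d = 0\<close>. Knowing \<open>d = 0\<close> removes the undifferentiated
        \<open>d\<close> from the derivative computed next.\<close>
      then have d0: "d q = 0" using pde[OF q(1)] B0 by simp
      have ld: "((\<lambda>t. f (q + t *\<^sub>R ?n)) has_real_derivative pd ?n f q) (at 0)" if "Cinf_on Q f" for f :: "real \<times> real \<Rightarrow> real"
      proof -
        have "q + 0 *\<^sub>R ?n = q" unfolding scaleR_zero_left by simp
        then show ?thesis using Cinf_on_line_derivative[OF that, of q 0 ?n] q(1) by metis
      qed
      let ?f = "\<lambda>q. A q * (B q * c q - A q * d q) - B q * (B q * a q - A q * b q)"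
      have "((\<lambda>t. ?f (q + t *\<^sub>R ?n)) has_real_derivative A q * (c q * c q - A q * pd ?n d q) + c q * (A q * b q)) (at 0)"
        by (rule derivative_eq_intros ld A B abcd refl)+
          (use B0 d0 in \<open>simp add: c_def algebra_simps flip: zero_prod_def\<close>)
      moreover have "((\<lambda>t. ?f (q + t *\<^sub>R ?n)) has_real_derivative 0) (at 0)"
      proof -
        have "((\<lambda>t. q + t *\<^sub>R ?n) \<longlongrightarrow> q + 0 *\<^sub>R ?n) (nhds 0)"
          by (intro tendsto_intros filterlim_ident)
        then have "\<forall>\<^sub>F t in nhds 0. q + t *\<^sub>R ?n \<in> Q"
          using l(2) q(1) unfolding scaleR_zero_left add_0_right by (rule topological_tendstoD)
        then have "\<forall>\<^sub>F t in nhds 0. ?f (q + t *\<^sub>R ?n) = 0"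
          by eventually_elim (rule pde)
        then show ?thesis by (subst DERIV_cong_ev[OF refl _ refl, where g = "\<lambda>t. 0"]) auto
      qed
      ultimately have "A q * (c q * c q - A q * pd ?n d q) + c q * (A q * b q) = 0"
        by (rule DERIV_unique)
      then have "A q * h q = 0" by (simp add: h_def algebra_simps)
      then show False using An q(2) by simp
    qed
    moreover have "(n1\<^sup>2 + n2\<^sup>2) * F q = n1 * A q - n2 * B q" "(n1\<^sup>2 + n2\<^sup>2) * G q = n2 * A q + n1 * B q"
      by (simp_all add: A_def B_def F_def G_def algebra_simps power2_eq_square)
    ultimately show "F q = 0 \<and> G q = 0" using assms(6) B0 by simp
  qed (simp add: B_def F_def G_def)
  ultimately show thesis
    using that[OF _ _ _ B] c0 unfolding F_def G_def c_def by blast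
qed

text \<open>The condition of \<open>C1_curve\<close> at a single point, applied to the whole
  singular set because the components are compared only at the end.\<close>

definition is_curve_near :: "heis set \<Rightarrow> heis \<Rightarrow> bool" where
  "is_curve_near S p \<longleftrightarrow>
     (\<exists>U \<gamma>. open U \<and> p \<in> U \<and>
        \<gamma> C1_differentiable_on {0<..<1::real} \<and>
        (\<forall>t\<in>{0<..<1}. vector_derivative \<gamma> (at t) \<noteq> 0) \<and>
        (\<exists>\<delta>. homeomorphism {0<..<1} (S \<inter> U) \<gamma> \<delta>))"

lemma Cinf_on_imp_C1_differentiable:
  fixes \<gamma> :: "real \<Rightarrow> 'a::euclidean_space"
  assumes "Cinf_on S \<gamma>"
  shows "\<gamma> C1_differentiable_on S"
  unfolding C1_differentiable_on_def
proof (intro exI conjI ballI)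
  fix t assume "t \<in> S"
  then have D: "(\<gamma> has_derivative frechet_derivative \<gamma> (at t)) (at t)"
    using Cinf_on_has_derivative[OF assms] by blast
  show "(\<gamma> has_vector_derivative pd 1 \<gamma> t) (at t)"
    by (rule has_vector_derivative_fun_compose[where \<gamma> = "\<lambda>s. s", OF _ D])
      (simp add: has_vector_derivative_def)
next
  show "continuous_on S (pd 1 \<gamma>)" using Cinf_on_imp_continuous_on[OF Cinf_on_pd[OF assms]] .
qed

text \<open>Near \<open>q0\<close> the singular set lies over \<open>B = 0\<close>. Since
  \<open>B\<close> has nonzero derivative along \<open>n\<close>, it forms a smooth coordinate
  system together with the linear coordinate \<open>\<mu>\<close> orthogonal to \<open>n\<close>; in
  it the singular set is a straight segment, which \<open>\<mu>\<close> parametrizes.\<close>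

lemma degenerate_singular_point_curve:
  fixes n1 n2 :: real
  assumes "p_minimal M" "local_graph M V Q u" "q0 \<in> Q"
    and "contact_x u q0 = 0" "contact_y u q0 = 0" "n1\<^sup>2 + n2\<^sup>2 = 1"
    and deg: "\<And>v. n1 * frechet_derivative (contact_x u) (at q0) v
       + n2 * frechet_derivative (contact_y u) (at q0) v = 0"
  shows "is_curve_near (singular_set M) (graph_map u q0)"
proof -
  note l = local_graphD[OF assms(2)]
  define B where "B = (\<lambda>q. - n2 * contact_x u q + n1 * contact_y u q)"
  obtain P where P: "open P" "q0 \<in> P" "P \<subseteq> Q" "Cinf_on Q B" "pd (n1, n2) B q0 = 2"
    "\<And>q. q \<in> P \<Longrightarrow> B q = 0 \<longleftrightarrow> contact_x u q = 0 \<and> contact_y u q = 0"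
    by (rule degenerate_point_coefficients[OF assms]) (rule that; simp add: B_def)
  define \<mu> where "\<mu> = (\<lambda>q::real \<times> real. - n2 * fst q + n1 * snd q)"
  have mu: "bounded_linear \<mu>" unfolding \<mu>_def
    by (rule bounded_linear_add[OF bounded_linear_compose[OF bounded_linear_mult_right bounded_linear_fst]
          bounded_linear_compose[OF bounded_linear_mult_right bounded_linear_snd]])
  define \<Psi> where "\<Psi> = (\<lambda>q. (\<mu> q, B q))"
  have BP: "Cinf_on P B" using Cinf_on_subset[OF P(3,4)] .
  have Psi: "Cinf_on P \<Psi>" unfolding \<Psi>_def
    by (intro Cinf_on_Pair P(1) BP Cinf_on_bounded_linear[OF _ mu])
  have "(\<Psi> has_derivative (\<lambda>v. (\<mu> v, frechet_derivative B (at q0) v))) (at q0)"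
    unfolding \<Psi>_def by (intro has_derivative_Pair bounded_linear_imp_has_derivative mu
        Cinf_on_has_derivative[OF BP P(2)])
  then have DPsi: "frechet_derivative \<Psi> (at q0) = (\<lambda>v. (\<mu> v, frechet_derivative B (at q0) v))"
    and linPsi: "linear (\<lambda>v. (\<mu> v, frechet_derivative B (at q0) v))"
    by (rule frechet_derivative_at[symmetric], rule has_derivative_linear)
  have "inj (frechet_derivative \<Psi> (at q0))"
    unfolding DPsi linear_injective_0[OF linPsi]
  proof (intro allI impI)
    fix v :: "real \<times> real" assume 0: "(\<mu> v, frechet_derivative B (at q0) v) = 0"
    \<comment> \<open>\<open>\<mu> v = 0\<close> makes \<open>v\<close> a multiple of
      \<open>n\<close>, and along \<open>n\<close> the derivative of \<open>B\<close> is 2.\<close>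
    define t where "t = n1 * fst v + n2 * snd v"
    have "fst v * (n1\<^sup>2 + n2\<^sup>2) = t * n1 - n2 * \<mu> v" "snd v * (n1\<^sup>2 + n2\<^sup>2) = t * n2 + n1 * \<mu> v"
      by (simp_all add: t_def \<mu>_def algebra_simps power2_eq_square)
    then have v: "v = t *\<^sub>R (n1, n2)" using 0 assms(6) by (simp add: prod_eq_iff zero_prod_def)
    have "linear (frechet_derivative B (at q0))"
      using has_derivative_linear[OF Cinf_on_has_derivative[OF BP P(2)]] .
    then have "frechet_derivative B (at q0) v = t * 2"
      unfolding v using P(5) by (simp only: linear_scale real_scaleR_def)
    then show "v = 0" using 0 v by (simp add: zero_prod_def)
  qed
  then obtain U' V' g where g: "open U'" "U' \<subseteq> P" "q0 \<in> U'" "open V'" "\<Psi> q0 \<in> V'"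
    "homeomorphism U' V' \<Psi> g" "Cinf_on V' g"
    using smooth_inverse_function_plane[OF P(1) Psi P(2)] by metis
  define s0 where "s0 = \<mu> q0"
  have B0: "B q0 = 0" using P(2,6) assms(4,5) by blast
  then have "(s0, 0) \<in> V'" using g(5) by (simp add: \<Psi>_def s0_def)
  then obtain \<epsilon> where e: "\<epsilon> > 0" "ball (s0, 0) \<epsilon> \<subseteq> V'" using g(4) open_contains_ball by blast
  \<comment> \<open>Cutting down to the preimage of a ball makes the zeros of \<open>B\<close> in
    \<open>U2\<close> exactly one full segment, with no stray pieces.\<close>
  define U2 where "U2 = U' \<inter> \<Psi> -` ball (s0, 0) \<epsilon>"
  have U2: "open U2" unfolding U2_def
    using continuous_open_preimage[OF Cinf_on_imp_continuous_on[OF Cinf_on_subset[OF g(2) Psi]] g(1)] by blast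
  have U2Q: "U2 \<subseteq> Q" using g(2) P(3) by (auto simp: U2_def)
  have q0U2: "q0 \<in> U2" using g(3) e(1) B0 by (simp add: U2_def \<Psi>_def s0_def)
  \<comment> \<open>The affine map of \<open>{0<..<1}\<close> onto the interval of radius
    \<open>\<epsilon>\<close> about \<open>s0\<close>; \<open>\<delta>\<close> below inverts it
    after reading off \<open>\<mu>\<close>.\<close>
  define \<sigma> where "\<sigma> = (\<lambda>t::real. s0 + \<epsilon> * (2 * t - 1))"
  have seg: "(\<sigma> t, 0) \<in> ball (s0, 0::real) \<epsilon>" if "t \<in> {0<..<1}" for t
  proof -
    have "\<bar>2 * t - 1\<bar> < 1" using that by (simp add: abs_less_iff)
    then have "\<bar>\<epsilon> * (2 * t - 1)\<bar> < \<epsilon>"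
      using mult_strict_left_mono[of "\<bar>2 * t - 1\<bar>" 1 \<epsilon>] e(1) by (simp add: abs_mult)
    then show ?thesis by (simp add: \<sigma>_def dist_Pair_Pair dist_real_def)
  qed
  define \<gamma> where "\<gamma> = (\<lambda>t. graph_map u (g (\<sigma> t, 0)))"
  define \<delta> where "\<delta> = (\<lambda>p. ((\<mu> (hproj p) - s0) / \<epsilon> + 1) / 2)"
  have gU: "g y \<in> U'" "\<Psi> (g y) = y" if "y \<in> V'" for y
    using g(6) that by (auto simp: homeomorphism_def)
  have gPsi: "g (\<Psi> q) = q" if "q \<in> U'" for q
    using g(6) that by (auto simp: homeomorphism_def)
  have gseg: "g (\<sigma> t, 0) \<in> U2" "\<mu> (g (\<sigma> t, 0)) = \<sigma> t" "B (g (\<sigma> t, 0)) = 0" if "t \<in> {0<..<1}" for t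
    using gU[of "(\<sigma> t, 0)"] seg[OF that] e(2) by (auto simp: U2_def \<Psi>_def)
  have sig: "Cinf_on {0<..<1} (\<lambda>t. (\<sigma> t, 0::real))"
    unfolding \<sigma>_def by (intro Cinf_intros open_greaterThanLessThan)
  have gsm: "Cinf_on {0<..<1} (\<lambda>t. g (\<sigma> t, 0))"
    by (rule Cinf_on_compose[OF open_greaterThanLessThan _ sig g(7)]) (use seg e(2) in auto)
  have "Cinf_on {0<..<1} (\<lambda>t. u (g (\<sigma> t, 0)))"
    by (rule Cinf_on_compose[OF open_greaterThanLessThan _ gsm l(3)]) (use gseg(1) U2Q in auto)
  then have gamma: "Cinf_on {0<..<1} \<gamma>"
    unfolding \<gamma>_def graph_map_def by (intro Cinf_intros open_greaterThanLessThan gsm)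
  have dg: "\<delta> (\<gamma> t) = t" if "t \<in> {0<..<1}" for t
    using gseg(2)[OF that] e(1) by (simp add: \<delta>_def \<gamma>_def \<sigma>_def)
  let ?U = "V \<inter> hproj -` U2"
  have lg: "local_graph M ?U U2 u" using local_graph_restrict[OF assms(2) U2 U2Q] .
  note l2 = local_graphD[OF lg]
  have sing: "graph_map u q \<in> singular_set M \<longleftrightarrow> B q = 0" if "q \<in> U2" for q
    using singular_graph_iff[OF lg that] P(6)[of q] that g(2) by (auto simp: U2_def)
  have "homeomorphism {0<..<1} (singular_set M \<inter> ?U) \<gamma> \<delta>"
  proof (rule homeomorphismI)
    show "continuous_on {0<..<1} \<gamma>" using Cinf_on_imp_continuous_on[OF gamma] .
    show "continuous_on (singular_set M \<inter> ?U) \<delta>" unfolding \<delta>_def using e(1)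
      by (intro continuous_intros linear_continuous_on_compose[OF continuous_on_hproj bounded_linear.linear[OF mu]]) auto
    show "\<gamma> ` {0<..<1} \<subseteq> singular_set M \<inter> ?U"
    proof (rule image_subsetI)
      fix t :: real assume t: "t \<in> {0<..<1}"
      show "\<gamma> t \<in> singular_set M \<inter> ?U"
        unfolding \<gamma>_def using sing[OF gseg(1)[OF t]] gseg(3)[OF t] l2(5)[OF gseg(1)[OF t]] by blast
    qed
    have bk: "\<delta> p \<in> {0<..<1} \<and> \<gamma> (\<delta> p) = p" if p: "p \<in> singular_set M \<inter> ?U" for p
    proof -
      have pM: "p \<in> M" using p by (simp add: singular_set_def)
      define q where "q = hproj p"
      have q: "q \<in> U2" "graph_map u q = p" using l2(6,7)[OF pM] p by (auto simp: q_def)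
      have Bq: "B q = 0" using sing[OF q(1)] q(2) p by simp
      then have Psiq: "\<Psi> q = (\<mu> q, 0)" by (simp add: \<Psi>_def)
      have "(\<mu> q, 0) \<in> ball (s0, 0::real) \<epsilon>" using q(1) Psiq by (auto simp: U2_def)
      then have "\<bar>\<mu> q - s0\<bar> < \<epsilon>" by (simp add: dist_Pair_Pair dist_real_def abs_minus_commute)
      then have "\<bar>(\<mu> q - s0) / \<epsilon>\<bar> < 1" using e(1) by simp
      then have "- 1 < (\<mu> q - s0) / \<epsilon>" "(\<mu> q - s0) / \<epsilon> < 1" by linarith+
      then have d: "\<delta> p \<in> {0<..<1}" unfolding \<delta>_def q_def[symmetric] by auto
      have "\<sigma> (\<delta> p) = \<mu> q" using e(1) by (simp add: \<sigma>_def \<delta>_def q_def field_simps)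
      then have "\<gamma> (\<delta> p) = graph_map u (g (\<Psi> q))" by (simp add: \<gamma>_def Psiq)
      also have "\<dots> = p" using gPsi q by (simp add: U2_def)
      finally show ?thesis using d by simp
    qed
    then show "\<delta> ` (singular_set M \<inter> ?U) \<subseteq> {0<..<1}" "\<And>y. y \<in> singular_set M \<inter> ?U \<Longrightarrow> \<gamma> (\<delta> y) = y" by blast+
  qed (use dg in auto)
  moreover have "vector_derivative \<gamma> (at t) \<noteq> 0" if t: "t \<in> {0<..<1}" for t
  proof
    assume 0: "vector_derivative \<gamma> (at t) = 0"
    have "\<gamma> differentiable (at t)"
      using Cinf_on_has_derivative[OF gamma t] differentiable_def by blast
    then have g0: "(\<gamma> has_vector_derivative 0) (at t)" using 0 vector_derivative_works by metis
    \<comment> \<open>The linear function \<open>\<mu>\<close> of the projection recovers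
      \<open>\<sigma>\<close>, which has speed \<open>2 * \<epsilon>\<close>; so
      \<open>\<gamma>\<close> cannot have velocity 0.\<close>
    have "((\<lambda>p. \<mu> (hproj p)) has_derivative (\<lambda>p. \<mu> (hproj p))) (at (\<gamma> t))"
      using bounded_linear_compose[OF mu bounded_linear_hproj] by (rule bounded_linear_imp_has_derivative)
    from has_vector_derivative_fun_compose[OF g0 this]
    have "((\<lambda>t. \<mu> (hproj (\<gamma> t))) has_vector_derivative 0) (at t)"
      using linear_0[OF bounded_linear.linear[OF bounded_linear_compose[OF mu bounded_linear_hproj]]] by simp
    then have "(\<sigma> has_vector_derivative 0) (at t)"
      by (rule has_vector_derivative_transform_within_open[OF _ open_greaterThanLessThan t])
        (simp add: \<gamma>_def gseg(2))
    moreover have "(\<sigma> has_vector_derivative (\<epsilon> * 2)) (at t)"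
      unfolding \<sigma>_def has_real_derivative_iff_has_vector_derivative[symmetric]
      by (auto intro!: derivative_eq_intros)
    ultimately show False using vector_derivative_unique_at e(1) by fastforce
  qed
  moreover have "graph_map u q0 \<in> ?U" using l2(5)[OF q0U2] .
  ultimately show ?thesis
    unfolding is_curve_near_def using l2(1) Cinf_on_imp_C1_differentiable[OF gamma] by blast
qed


section \<open>Nondegenerate singular points\<close>

text \<open>The leading order of the equation at a nondegenerate singular point is a quadratic form
  identity in the values of the contact coefficients, which here are arbitrary.\<close>

lemma nondegenerate_point_derivatives:
  fixes u :: "real \<times> real \<Rightarrow> real"
  assumes "p_minimal M" "local_graph M V Q u" "q0 \<in> Q"
    and "contact_x u q0 = 0" "contact_y u q0 = 0"
    and nd: "pd (1, 0) (contact_x u) q0 * pd (0, 1) (contact_y u) q0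
       - pd (0, 1) (contact_x u) q0 * pd (1, 0) (contact_y u) q0 \<noteq> 0"
  shows "frechet_derivative (contact_x u) (at q0) v = - snd v"
    and "frechet_derivative (contact_y u) (at q0) v = fst v"
proof -
  note l = local_graphD[OF assms(2)]
  define F where "F = contact_x u"
  define G where "G = contact_y u"
  have FG: "Cinf_on Q F" "Cinf_on Q G"
    using Cinf_on_contact[OF l(2,3)] by (simp_all add: F_def G_def)
  have ex: "frechet_derivative h (at q) v = fst v * pd (1, 0) h q + snd v * pd (0, 1) h q"
    if "Cinf_on Q h" "q \<in> Q" for h :: "real \<times> real \<Rightarrow> real" and q v
    using plane_linear_expand[OF has_derivative_linear[OF Cinf_on_has_derivative[OF that]], of "fst v" "snd v"]
    by simp
  define fx fy gx gy where "fx = pd (1, 0) F q0" and "fy = pd (0, 1) F q0"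
    and "gx = pd (1, 0) G q0" and "gy = pd (0, 1) G q0"
  define dt where "dt = fx * gy - fy * gx"
  have dt: "dt \<noteq> 0" using nd by (simp add: dt_def fx_def fy_def gx_def gy_def F_def G_def)
  have quad: "f * (g * gx - f * gy) = g * (g * fx - f * fy)" for f g
  proof -
    \<comment> \<open>Solved by Cramer's rule: the direction in which \<open>(F, G)\<close> leaves
      \<open>q0\<close> with velocity \<open>(f, g)\<close>. Invertibility makes every pair
      \<open>(f, g)\<close> available.\<close>
    define v where "v = ((gy * f - fy * g) / dt, (fx * g - gx * f) / dt)"
    have Lv: "fst v * fx + snd v * fy = f" "fst v * gx + snd v * gy = g"
    proof -
      have "(gy * f - fy * g) * fx + (fx * g - gx * f) * fy = f * dt"
        "(gy * f - fy * g) * gx + (fx * g - gx * f) * gy = g * dt"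
        by (simp_all add: dt_def algebra_simps)
      then show "fst v * fx + snd v * fy = f" "fst v * gx + snd v * gy = g"
        unfolding v_def fst_conv snd_conv times_divide_eq_left add_divide_distrib[symmetric]
        using dt by simp_all
    qed
    have q0: "q0 + 0 *\<^sub>R v = q0" by simp
    have F': "((\<lambda>t. F (q0 + t *\<^sub>R v) / t) \<longlongrightarrow> f) (at 0)" and G': "((\<lambda>t. G (q0 + t *\<^sub>R v) / t) \<longlongrightarrow> g) (at 0)"
      using Cinf_on_line_derivative[OF FG(1), of q0 0 v] Cinf_on_line_derivative[OF FG(2), of q0 0 v]
      unfolding q0 ex[OF FG(1) assms(3), of v] ex[OF FG(2) assms(3), of v]
        fx_def[symmetric] fy_def[symmetric] gx_def[symmetric] gy_def[symmetric] Lv DERIV_def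
      using assms(3-5) by (simp_all add: F_def G_def)
    have lim: "((\<lambda>t. h (q0 + t *\<^sub>R v)) \<longlongrightarrow> h q0) (at 0)" if "Cinf_on Q h" for h :: "real \<times> real \<Rightarrow> real"
    proof -
      have "isCont h q0"
        using Cinf_on_imp_continuous_on[OF that] l(2) assms(3) continuous_on_eq_continuous_at by blast
      moreover have "((\<lambda>t. q0 + t *\<^sub>R v) \<longlongrightarrow> q0 + 0 *\<^sub>R v) (at 0)" by (intro tendsto_intros)
      ultimately show ?thesis unfolding q0 by (rule isCont_tendsto_compose)
    qed
    \<comment> \<open>The equation at \<open>q0 + t *\<^sub>R v\<close> divided by
      \<open>t^2\<close>. In the limit the values of \<open>F\<close> and \<open>G\<close> become
      \<open>f\<close> and \<open>g\<close>, and the partial derivatives take their values at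
      \<open>q0\<close>.\<close>
    let ?P = "\<lambda>t. (F (q0 + t *\<^sub>R v) / t) * ((G (q0 + t *\<^sub>R v) / t) * pd (1, 0) G (q0 + t *\<^sub>R v)
         - (F (q0 + t *\<^sub>R v) / t) * pd (0, 1) G (q0 + t *\<^sub>R v))
       - (G (q0 + t *\<^sub>R v) / t) * ((G (q0 + t *\<^sub>R v) / t) * pd (1, 0) F (q0 + t *\<^sub>R v)
         - (F (q0 + t *\<^sub>R v) / t) * pd (0, 1) F (q0 + t *\<^sub>R v))"
    have "(?P \<longlongrightarrow> f * (g * gx - f * gy) - g * (g * fx - f * fy)) (at 0)"
      unfolding fx_def fy_def gx_def gy_def
      by (intro tendsto_diff tendsto_mult F' G' lim Cinf_on_pd FG)
    moreover have "(?P \<longlongrightarrow> 0) (at 0)"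
    proof (rule tendsto_eventually)
      have "((\<lambda>t. q0 + t *\<^sub>R v) \<longlongrightarrow> q0 + 0 *\<^sub>R v) (at 0)" by (intro tendsto_intros)
      then have "\<forall>\<^sub>F t in at 0. q0 + t *\<^sub>R v \<in> Q"
        using l(2) assms(3) unfolding q0 by (rule topological_tendstoD)
      then show "\<forall>\<^sub>F t in at 0. ?P t = 0"
      proof eventually_elim
        case (elim t)
        let ?q = "q0 + t *\<^sub>R v"
        have "F ?q * (G ?q * pd (1, 0) G ?q - F ?q * pd (0, 1) G ?q)
            - G ?q * (G ?q * pd (1, 0) F ?q - F ?q * pd (0, 1) F ?q) = 0"
          using p_minimal_graph_equation[OF assms(1,2) elim]
          unfolding F_def[symmetric] G_def[symmetric] ex[OF FG(1) elim, of "(G ?q, - F ?q)"]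
            ex[OF FG(2) elim, of "(G ?q, - F ?q)"] by simp
        moreover have "?P t = (F ?q * (G ?q * pd (1, 0) G ?q - F ?q * pd (0, 1) G ?q)
            - G ?q * (G ?q * pd (1, 0) F ?q - F ?q * pd (0, 1) F ?q)) / (t * t)"
          by (simp add: diff_divide_distrib right_diff_distrib)
        ultimately show ?case by simp
      qed
    qed
    ultimately have "f * (g * gx - f * gy) - g * (g * fx - f * fy) = 0"
      using tendsto_unique[OF at_neq_bot] by blast
    then show ?thesis by simp
  qed
  \<comment> \<open>The pairs \<open>(1, 0)\<close> and \<open>(0, 1)\<close> isolate the square
    terms of the form. The pair \<open>(1, 1)\<close> then gives \<open>gx + fy = 0\<close>, and the
    curl \<open>gx - fy = 2\<close> fixes both values.\<close>
  have "gy = 0" "fx = 0" using quad[of 1 0] quad[of 0 1] by simp_all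
  moreover from this quad[of 1 1] contact_curl[OF l(2,3) assms(3)] have "gx = 1" "fy = - 1"
    by (simp_all add: gx_def fy_def F_def G_def)
  ultimately show "frechet_derivative (contact_x u) (at q0) v = - snd v"
    "frechet_derivative (contact_y u) (at q0) v = fst v"
    using ex[OF FG(1) assms(3), of v] ex[OF FG(2) assms(3), of v]
    by (simp_all add: fx_def fy_def gx_def gy_def F_def G_def)
qed

text \<open>Let \<open>F\<close>, \<open>G\<close> be the contact coefficients and \<open>k\<close> the left-hand side of the last conclusion.
  Along \<open>W = (G, - F)\<close>, the direction of the characteristic lines, \<open>k\<^sup>2 / (F\<^sup>2 + G\<^sup>2)\<close> is
  constant while the distance to \<open>q0\<close> increases. So the quotient of the former by the squared
  distance, which tends to \<open>0\<close> at \<open>q0\<close>, has no positive maximum on a small disc, and \<open>k = 0\<close>.\<close>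

lemma nondegenerate_point_radial:
  fixes u :: "real \<times> real \<Rightarrow> real"
  assumes "p_minimal M" "local_graph M V Q u" "q0 \<in> Q"
    and "contact_x u q0 = 0" "contact_y u q0 = 0"
    and nd: "pd (1, 0) (contact_x u) q0 * pd (0, 1) (contact_y u) q0
       - pd (0, 1) (contact_x u) q0 * pd (1, 0) (contact_y u) q0 \<noteq> 0"
  obtains r where "r > 0" "cball q0 r \<subseteq> Q"
    "\<And>q. q \<in> cball q0 r \<Longrightarrow> (fst q - fst q0) * contact_x u q + (snd q - snd q0) * contact_y u q = 0"
proof -
  note l = local_graphD[OF assms(2)]
  define F where "F = contact_x u"
  define G where "G = contact_y u"
  have FG: "Cinf_on Q F" "Cinf_on Q G"
    using Cinf_on_contact[OF l(2,3)] by (simp_all add: F_def G_def)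
  define X where "X = (\<lambda>q::real \<times> real. fst q - fst q0)"
  define Y where "Y = (\<lambda>q::real \<times> real. snd q - snd q0)"
  define k where "k = (\<lambda>q. X q * F q + Y q * G q)"
  define R where "R = (\<lambda>q. X q * X q + Y q * Y q)"
  define S where "S = (\<lambda>q. F q * F q + G q * G q)"
  define s where "s = (\<lambda>q. X q * G q - Y q * F q)"
  \<comment> \<open>\<open>k^2 / S\<close> is the squared distance from \<open>q0\<close> to the
    line through \<open>q\<close> in direction \<open>(G, - F)\<close>, so \<open>\<Phi>\<close> is
    the squared sine of the angle between this line and the ray from \<open>q0\<close>. At
    \<open>q0\<close> the division by 0 yields 0, which is also the limit.\<close>
  define \<Phi> where "\<Phi> = (\<lambda>q. k q * k q / (S q * R q))"
  have Rd: "R q = (dist q q0)\<^sup>2" for q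
    by (simp add: R_def X_def Y_def dist_norm norm_prod_def power2_eq_square)
  have FG0: "F q0 = 0" "G q0 = 0" using assms(4,5) by (simp_all add: F_def G_def)
  have dF: "(F has_derivative (\<lambda>v. - snd v)) (at q0)" "(G has_derivative fst) (at q0)"
    using Cinf_on_has_derivative[OF FG(1) assms(3)] Cinf_on_has_derivative[OF FG(2) assms(3)]
      nondegenerate_point_derivatives[OF assms] unfolding F_def G_def by (metis ext)+
  have near: "\<exists>d>0. \<forall>q\<in>ball q0 d. \<bar>F q + Y q\<bar> \<le> e * dist q q0 \<and> \<bar>G q - X q\<bar> \<le> e * dist q q0" if e: "e > 0" for e
  proof -
    obtain d1 where d1: "d1 > 0" "\<And>q. norm (q - q0) < d1 \<Longrightarrow> norm (F q - F q0 - (- snd (q - q0))) \<le> e * norm (q - q0)"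
      using dF(1) e unfolding has_derivative_at_alt by blast
    obtain d2 where d2: "d2 > 0" "\<And>q. norm (q - q0) < d2 \<Longrightarrow> norm (G q - G q0 - fst (q - q0)) \<le> e * norm (q - q0)"
      using dF(2) e unfolding has_derivative_at_alt by blast
    show ?thesis
    proof (intro exI[of _ "min d1 d2"] conjI ballI)
      fix q assume "q \<in> ball q0 (min d1 d2)"
      then have "norm (q - q0) < d1" "norm (q - q0) < d2" by (auto simp: dist_norm norm_minus_commute)
      from d1(2)[OF this(1)] d2(2)[OF this(2)]
      show "\<bar>F q + Y q\<bar> \<le> e * dist q q0" "\<bar>G q - X q\<bar> \<le> e * dist q q0"
        by (simp_all add: FG0 X_def Y_def dist_norm)
    qed (use d1 d2 in auto)
  qed
  have XY: "\<bar>X q\<bar> \<le> dist q q0" "\<bar>Y q\<bar> \<le> dist q q0" for q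
    using norm_fst_le[of "fst (q - q0)" "snd (q - q0)"] norm_snd_le[of "snd (q - q0)" "fst (q - q0)"]
    unfolding prod.collapse by (simp_all add: X_def Y_def dist_norm)
  have prod_le: "\<bar>a * b\<bar> \<le> e * (dist q q0)\<^sup>2" if "\<bar>a\<bar> \<le> dist q q0" "\<bar>b\<bar> \<le> e * dist q q0" for a b e q
  proof -
    have "\<bar>a * b\<bar> \<le> dist q q0 * (e * dist q q0)"
      unfolding abs_mult by (rule mult_mono[OF that]) auto
    then show ?thesis by (simp add: power2_eq_square mult.left_commute)
  qed
  \<comment> \<open>With tolerance 1/4 the two error terms in \<open>s\<close> cost at most half of
    \<open>R\<close>. What is left, \<open>R \<le> 2 * s\<close>, says that \<open>(G, - F)\<close>
    points away from \<open>q0\<close>, as \<open>s\<close> is its inner product with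
    \<open>q - q0\<close>.\<close>
  obtain d0 where d0: "d0 > 0" "\<And>q. q \<in> ball q0 d0 \<Longrightarrow> \<bar>F q + Y q\<bar> \<le> 1/4 * dist q q0 \<and> \<bar>G q - X q\<bar> \<le> 1/4 * dist q q0"
    using near[of "1/4"] by auto
  obtain r1 where r1: "r1 > 0" "cball q0 r1 \<subseteq> Q" using l(2) assms(3) open_contains_cball by blast
  define r where "r = min r1 (d0 / 2)"
  have r: "r > 0" "cball q0 r \<subseteq> Q" "cball q0 r \<subseteq> ball q0 d0" using r1 d0(1) by (auto simp: r_def)
  have s_ge: "R q \<le> 2 * s q" if "q \<in> ball q0 d0" for q
  proof -
    have "\<bar>X q * (G q - X q)\<bar> \<le> 1/4 * (dist q q0)\<^sup>2" "\<bar>Y q * (F q + Y q)\<bar> \<le> 1/4 * (dist q q0)\<^sup>2"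
      using d0(2)[OF that] XY by (intro prod_le; simp)+
    moreover have "s q = R q + X q * (G q - X q) - Y q * (F q + Y q)"
      by (simp add: s_def R_def algebra_simps)
    ultimately show ?thesis unfolding Rd by linarith
  qed
  have S_ge: "R q \<le> 4 * S q" if "q \<in> ball q0 d0" for q
  proof (cases "R q = 0")
    case True
    then show ?thesis by (simp add: S_def)
  next
    case False
    then have R0: "R q > 0" by (simp add: Rd)
    \<comment> \<open>Lagrange's identity for the vectors \<open>q - q0\<close> and
      \<open>(F, G)\<close>.\<close>
    have "(s q)\<^sup>2 + (k q)\<^sup>2 = R q * S q"
      by (simp add: s_def k_def R_def S_def algebra_simps power2_eq_square)
    then have "(s q)\<^sup>2 \<le> R q * S q" by (smt (verit) zero_le_power2)
    moreover have "(R q)\<^sup>2 \<le> (2 * s q)\<^sup>2" using s_ge[OF that] R0 by (intro power_mono) auto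
    ultimately have "R q * R q \<le> R q * (4 * S q)" by (simp add: power2_eq_square)
    then show ?thesis using R0 by simp
  qed
  have R_pos: "R q > 0" if "q \<noteq> q0" for q using that by (simp add: Rd)
  have S_pos: "S q > 0" if "q \<noteq> q0" "q \<in> ball q0 d0" for q using S_ge[OF that(2)] R_pos[OF that(1)] by simp
  have smooth: "Cinf_on Q X" "Cinf_on Q Y" unfolding X_def Y_def by (intro Cinf_intros l(2))+
  have smooth': "Cinf_on Q k" "Cinf_on Q S" "Cinf_on Q R"
    unfolding k_def S_def R_def by (intro Cinf_intros l(2) smooth FG)+
  have contPhi: "continuous_on (cball q0 r) \<Phi>"
    unfolding continuous_on_eq_continuous_within
  proof
    fix q assume q: "q \<in> cball q0 r"
    show "continuous (at q within cball q0 r) \<Phi>"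
    proof (cases "q = q0")
      case False
      have c: "isCont h q" if "Cinf_on Q h" for h :: "real \<times> real \<Rightarrow> real"
        using Cinf_on_imp_continuous_on[OF that] l(2) q r(2) continuous_on_eq_continuous_at by blast
      have "S q * R q \<noteq> 0" using S_pos[OF False] R_pos[OF False] q r(3) by force
      then have "isCont \<Phi> q" unfolding \<Phi>_def by (intro continuous_intros c smooth')
      then show ?thesis by (rule continuous_at_imp_continuous_within)
    next
      case True
      have Phi0: "\<Phi> q0 = 0" by (simp add: \<Phi>_def R_def X_def Y_def)
      show ?thesis
        unfolding True continuous_within_eps_delta
      proof (intro allI impI)
        fix e :: real assume "e > 0"
        \<comment> \<open>The estimates \<open>\<bar>k\<bar> \<le> 2 * c * R\<close> and
          \<open>R \<le> 4 * S\<close> will give \<open>\<Phi> \<le> 16 * c^2\<close>, and any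
          divisor of \<open>sqrt e\<close> above 4 keeps this below \<open>e\<close>.\<close>
        define c where "c = sqrt e / 5"
        have c: "c > 0" "16 * c\<^sup>2 < e" using \<open>e > 0\<close> by (simp_all add: c_def power_divide)
        obtain d where d: "d > 0" "\<And>q. q \<in> ball q0 d \<Longrightarrow> \<bar>F q + Y q\<bar> \<le> c * dist q q0 \<and> \<bar>G q - X q\<bar> \<le> c * dist q q0"
          using near[OF c(1)] by auto
        show "\<exists>d>0. \<forall>x'\<in>cball q0 r. dist x' q0 < d \<longrightarrow> dist (\<Phi> x') (\<Phi> q0) < e"
        proof (intro exI[of _ d] conjI ballI impI)
          fix q assume q: "q \<in> cball q0 r" "dist q q0 < d"
          show "dist (\<Phi> q) (\<Phi> q0) < e"
          proof (cases "q = q0")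
            case False
            have qd: "q \<in> ball q0 d" "q \<in> ball q0 d0" using q r(3) by (auto simp: dist_commute)
            have "\<bar>X q * (F q + Y q)\<bar> \<le> c * (dist q q0)\<^sup>2" "\<bar>Y q * (G q - X q)\<bar> \<le> c * (dist q q0)\<^sup>2"
              using d(2)[OF qd(1)] XY by (intro prod_le; simp)+
            moreover have "k q = X q * (F q + Y q) + Y q * (G q - X q)"
              by (simp add: k_def algebra_simps)
            ultimately have "\<bar>k q\<bar> \<le> 2 * c * R q" unfolding Rd by linarith
            then have "\<bar>k q\<bar> * \<bar>k q\<bar> \<le> (2 * c * R q) * (2 * c * R q)"
              by (intro mult_mono) auto
            then have "k q * k q \<le> 4 * c\<^sup>2 * (R q * R q)"
              by (simp add: power2_eq_square algebra_simps)
            also have "\<dots> \<le> 4 * c\<^sup>2 * (4 * S q * R q)"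
              using S_ge[OF qd(2)] R_pos[OF False] by (intro mult_left_mono mult_right_mono) auto
            finally have "k q * k q \<le> 16 * c\<^sup>2 * (S q * R q)" by simp
            then have "\<Phi> q \<le> 16 * c\<^sup>2"
              unfolding \<Phi>_def using S_pos[OF False qd(2)] R_pos[OF False] by (simp add: divide_le_eq)
            moreover have "\<Phi> q \<ge> 0"
              unfolding \<Phi>_def using S_pos[OF False qd(2)] R_pos[OF False] by simp
            ultimately show ?thesis using c(2) Phi0 by (simp add: dist_real_def)
          qed (use \<open>e > 0\<close> in simp)
        qed (use d in auto)
      qed
    qed
  qed
  obtain q1 where q1: "q1 \<in> cball q0 r" "\<And>q. q \<in> cball q0 r \<Longrightarrow> \<Phi> q \<le> \<Phi> q1"
    using continuous_attains_sup[OF compact_cball _ contPhi] r(1) by fastforce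
  have "\<Phi> q1 \<le> 0"
  proof (rule ccontr)
    assume neg: "\<not> \<Phi> q1 \<le> 0"
    then have k1: "k q1 \<noteq> 0" by (auto simp: \<Phi>_def)
    have ne: "q1 \<noteq> q0" using neg by (auto simp: \<Phi>_def R_def X_def Y_def)
    have q1d: "q1 \<in> ball q0 d0" and q1Q: "q1 \<in> Q" using q1(1) r by auto
    note pos = R_pos[OF ne] S_pos[OF ne q1d]
    have s1: "s q1 > 0" using s_ge[OF q1d] pos by simp
    \<comment> \<open>The motion will be along \<open>- W\<close>, towards \<open>q0\<close>, so it
      remains in the closed disc even when the maximum lies on its boundary.\<close>
    define W where "W = (G q1, - F q1)"
    define a where "a = frechet_derivative F (at q1) W"
    define b where "b = frechet_derivative G (at q1) W"
    have pde: "F q1 * b = G q1 * a"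
      using p_minimal_graph_equation[OF assms(1,2) q1Q] by (simp add: a_def b_def W_def F_def G_def)
    \<comment> \<open>By \<open>pde\<close> the derivative \<open>(a, b)\<close> of
      \<open>(F, G)\<close> along \<open>W\<close> is parallel to \<open>(F, G)\<close>;
      \<open>c\<close> is the factor, found by projection.\<close>
    define c where "c = (F q1 * a + G q1 * b) / S q1"
    have ab: "a = c * F q1" "b = c * G q1"
    proof -
      have "a * S q1 = (F q1 * a + G q1 * b) * F q1" "b * S q1 = (F q1 * a + G q1 * b) * G q1"
        using pde by (simp_all add: S_def algebra_simps)
      then show "a = c * F q1" "b = c * G q1" using pos by (simp_all add: c_def field_simps)
    qed
    have q10: "q1 + 0 *\<^sub>R (- W) = q1" by simp
    have ld: "((\<lambda>t. h (q1 + t *\<^sub>R (- W))) has_real_derivative - frechet_derivative h (at q1) W) (at 0)" if "Cinf_on Q h" for h :: "real \<times> real \<Rightarrow> real"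
      using Cinf_on_line_derivative[OF that, of q1 0 "- W"] q1Q
        linear_neg[OF has_derivative_linear[OF Cinf_on_has_derivative[OF that q1Q]]] unfolding q10 by simp
    have dF1: "((\<lambda>t. F (q1 + t *\<^sub>R (- W))) has_real_derivative - (c * F q1)) (at 0)"
      and dG1: "((\<lambda>t. G (q1 + t *\<^sub>R (- W))) has_real_derivative - (c * G q1)) (at 0)"
      using ld[OF FG(1)] ld[OF FG(2)] ab by (simp_all add: a_def b_def)
    have dX: "((\<lambda>t. X (q1 + t *\<^sub>R (- W))) has_real_derivative - G q1) (at 0)"
      and dY: "((\<lambda>t. Y (q1 + t *\<^sub>R (- W))) has_real_derivative F q1) (at 0)"
      unfolding X_def Y_def W_def by (auto intro!: derivative_eq_intros)
    have dk: "((\<lambda>t. k (q1 + t *\<^sub>R (- W))) has_real_derivative - c * k q1) (at 0)"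
      unfolding k_def by (rule derivative_eq_intros dF1 dG1 dX dY refl)+
        (simp only: q10, simp add: algebra_simps)
    have dS: "((\<lambda>t. S (q1 + t *\<^sub>R (- W))) has_real_derivative - 2 * c * S q1) (at 0)"
      unfolding S_def by (rule derivative_eq_intros dF1 dG1 dX dY refl)+
        (simp only: q10, simp add: algebra_simps)
    have dR: "((\<lambda>t. R (q1 + t *\<^sub>R (- W))) has_real_derivative - 2 * s q1) (at 0)"
      unfolding R_def s_def by (rule derivative_eq_intros dF1 dG1 dX dY refl)+
        (simp only: q10, simp add: algebra_simps)
    \<comment> \<open>Since \<open>k^2\<close> and \<open>S\<close> scale at the same rate
      \<open>- 2 * c\<close>, the terms with \<open>c\<close> cancel, and only the decrease of
      \<open>R\<close> contributes.\<close>
    let ?d = "((- c * k q1 * k q1 + - c * k q1 * k q1) * (S q1 * R q1)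
        - k q1 * k q1 * (- 2 * c * S q1 * R q1 + - 2 * s q1 * S q1)) / ((S q1 * R q1) * (S q1 * R q1))"
    have dPhi: "((\<lambda>t. \<Phi> (q1 + t *\<^sub>R (- W))) has_real_derivative ?d) (at 0)"
      unfolding \<Phi>_def
      by (rule DERIV_cong[OF DERIV_divide[OF DERIV_mult[OF dk dk] DERIV_mult[OF dS dR]]], unfold q10)
        (use pos in \<open>simp_all add: algebra_simps\<close>)
    have d_eq: "?d = (2 * s q1 * S q1 * (k q1 * k q1)) / ((S q1 * R q1) * (S q1 * R q1))"
      by (simp add: algebra_simps)
    have kk: "k q1 * k q1 > 0" using k1 by (auto simp: zero_less_mult_iff linorder_neq_iff)
    have "2 * s q1 * S q1 * (k q1 * k q1) > 0"
      by (rule mult_pos_pos[OF mult_pos_pos[OF _ pos(2)] kk]) (simp add: s1)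
    then have "?d > 0"
      unfolding d_eq by (rule divide_pos_pos) (intro mult_pos_pos pos)
    from DERIV_pos_inc_right[OF dPhi this]
    obtain t1 where t1: "t1 > 0" "\<And>h. 0 < h \<Longrightarrow> h < t1 \<Longrightarrow> \<Phi> q1 < \<Phi> (q1 + h *\<^sub>R (- W))"
      unfolding add_0 q10 by auto
    have "- 2 * s q1 < 0" using s1 by simp
    from DERIV_neg_dec_right[OF dR this]
    obtain t2 where t2: "t2 > 0" "\<And>h. 0 < h \<Longrightarrow> h < t2 \<Longrightarrow> R (q1 + h *\<^sub>R (- W)) < R q1"
      unfolding add_0 q10 by auto
    define t where "t = min t1 t2 / 2"
    have t: "0 < t" "t < t1" "t < t2" using t1(1) t2(1) by (auto simp: t_def)
    have "dist (q1 + t *\<^sub>R (- W)) q0 < dist q1 q0"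
      using t2(2)[OF t(1,3)] unfolding Rd by (rule power_less_imp_less_base) simp
    then have "q1 + t *\<^sub>R (- W) \<in> cball q0 r" using q1(1) unfolding mem_cball by (metis dist_commute less_imp_le order_trans)
    then show False using q1(2) t1(2)[OF t(1,2)] by fastforce
  qed
  have "k q = 0" if q: "q \<in> cball q0 r" for q
  proof (cases "q = q0")
    case False
    have pos: "S q * R q > 0" using S_pos[OF False] R_pos[OF False] q r(3) by force
    have "k q * k q \<le> 0" using q1(2)[OF q] \<open>\<Phi> q1 \<le> 0\<close> pos unfolding \<Phi>_def
      by (smt (verit) divide_pos_pos)
    then show ?thesis by (metis mult_le_0_iff order.antisym)
  qed (simp add: k_def X_def Y_def)
  then show thesis using that[OF r(1,2)] by (simp add: k_def X_def Y_def F_def G_def)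
qed

text \<open>On a ray from \<open>q0\<close> the radial identity, divided by the ray parameter, says
  that \<open>u\<close> has the constant slope \<open>?c\<close> of the contact plane at the
  singular point. The mean value theorem turns this into the affine formula.\<close>

lemma nondegenerate_point_affine:
  fixes u :: "real \<times> real \<Rightarrow> real"
  assumes "p_minimal M" "local_graph M V Q u" "q0 \<in> Q"
    and "contact_x u q0 = 0" "contact_y u q0 = 0"
    and nd: "pd (1, 0) (contact_x u) q0 * pd (0, 1) (contact_y u) q0
       - pd (0, 1) (contact_x u) q0 * pd (1, 0) (contact_y u) q0 \<noteq> 0"
  obtains r where "r > 0" "ball q0 r \<subseteq> Q"
    "\<And>q. q \<in> ball q0 r \<Longrightarrow> u q = u q0 + snd q0 * (fst q - fst q0) - fst q0 * (snd q - snd q0)"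
proof -
  note l = local_graphD[OF assms(2)]
  obtain r where r: "r > 0" "cball q0 r \<subseteq> Q"
    "\<And>q. q \<in> cball q0 r \<Longrightarrow> (fst q - fst q0) * contact_x u q + (snd q - snd q0) * contact_y u q = 0"
    using nondegenerate_point_radial[OF assms] by blast
  have "u q = u q0 + snd q0 * (fst q - fst q0) - fst q0 * (snd q - snd q0)" if q: "q \<in> ball q0 r" for q
  proof -
    define v where "v = q - q0"
    let ?c = "snd q0 * fst v - fst q0 * snd v"
    have inb: "q0 + t *\<^sub>R v \<in> cball q0 r" if "0 \<le> t" "t \<le> 1" for t
    proof -
      have "norm (t *\<^sub>R v) \<le> 1 * norm v" unfolding norm_scaleR using that by (intro mult_right_mono) auto
      also have "norm v < r" using q by (simp add: v_def dist_norm norm_minus_commute)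
      finally show ?thesis by (simp add: dist_norm)
    qed
    have d: "((\<lambda>t. u (q0 + t *\<^sub>R v) - t * ?c) has_real_derivative pd v u (q0 + t *\<^sub>R v) - ?c) (at t)"
      if "0 \<le> t" "t \<le> 1" for t
    proof -
      have "((\<lambda>t. t * ?c) has_real_derivative ?c) (at t)" by (auto intro!: derivative_eq_intros)
      then show ?thesis
        by (intro DERIV_diff Cinf_on_line_derivative[OF l(3)]) (use inb[OF that] r(2) in auto)
    qed
    have z: "pd v u (q0 + t *\<^sub>R v) - ?c = 0" if "0 < t" "t < 1" for t
    proof -
      let ?q = "q0 + t *\<^sub>R v"
      have qb: "?q \<in> cball q0 r" using inb that by simp
      then have "?q \<in> Q" using r(2) by blast
      then have "pd v u ?q = fst v * pd (1, 0) u ?q + snd v * pd (0, 1) u ?q"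
        using plane_linear_expand[OF has_derivative_linear[OF Cinf_on_has_derivative[OF l(3)]], of ?q "fst v" "snd v"]
        by simp
      moreover have "t * (fst v * contact_x u ?q + snd v * contact_y u ?q) = 0"
        using r(3)[OF qb] by (simp add: algebra_simps)
      then have "fst v * contact_x u ?q + snd v * contact_y u ?q = 0" using that by simp
      ultimately show ?thesis by (simp add: contact_x_def contact_y_def algebra_simps)
    qed
    obtain t where "0 < t" "t < 1" "(u (q0 + 1 *\<^sub>R v) - 1 * ?c) - (u (q0 + 0 *\<^sub>R v) - 0 * ?c)
        = (1 - 0) * (pd v u (q0 + t *\<^sub>R v) - ?c)"
      using MVT2[OF zero_less_one d] by blast
    then have "u (q0 + v) - ?c - u q0 = 0" using z by simp
    then show ?thesis by (simp add: v_def)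
  qed
  then show thesis using that[OF r(1)] r(2) ball_subset_cball by blast
qed


section \<open>Flat discs\<close>

text \<open>The height function of the affine plane through \<open>p\<close> with direction
  \<open>contact_plane p\<close>, on which \<open>dz = y dx - x dy\<close> with the coefficients
  frozen at \<open>p\<close>.\<close>

definition plane_through :: "heis \<Rightarrow> real \<times> real \<Rightarrow> real" where
  "plane_through p q = snd (snd p) + fst (snd p) * (fst q - fst p) - fst p * (snd q - fst (snd p))"

definition flat_disc :: "heis \<Rightarrow> real \<Rightarrow> heis set" where
  "flat_disc p r = graph_map (plane_through p) ` ball (hproj p) r"

text \<open>At points over \<open>hproj p\<close> this is a junk value (division by \<open>0\<close>).\<close>

definition radial_field :: "heis \<Rightarrow> heis \<Rightarrow> heis" where
  "radial_field p m = (let v = hproj m - hproj p; n = sqrt (fst v * fst v + snd v * snd v) in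
     (fst v / n, snd v / n, (fst (snd p) * fst v - fst p * snd v) / n))"

lemma plane_through_has_derivative:
  "(plane_through p has_derivative (\<lambda>v. fst (snd p) * fst v - fst p * snd v)) (at q)"
  unfolding plane_through_def by (auto intro!: derivative_eq_intros)

lemma frechet_derivative_plane_through:
  "frechet_derivative (plane_through p) (at q) = (\<lambda>v. fst (snd p) * fst v - fst p * snd v)"
  by (rule frechet_derivative_at[OF plane_through_has_derivative, symmetric])

lemma Cinf_on_plane_through: "open Q \<Longrightarrow> Cinf_on Q (plane_through p)"
  unfolding plane_through_def by (intro Cinf_intros)

lemma contact_plane_through:
  "contact_x (plane_through p) q = fst (snd p) - snd q" "contact_y (plane_through p) q = fst q - fst p"
  by (simp_all add: contact_x_def contact_y_def frechet_derivative_plane_through)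

lemma local_graph_flat_disc: "local_graph (flat_disc p r) UNIV (ball (hproj p) r) (plane_through p)"
  by (simp add: local_graph_def flat_disc_def Cinf_on_plane_through)

lemma graph_map_plane_through_self [simp]: "graph_map (plane_through p) (hproj p) = p"
  by (simp add: graph_map_def plane_through_def hproj_def)

text \<open>The contact coefficients of this plane are the radius vector \<open>q - hproj p\<close>
  turned by a right angle, which vanishes only at the centre.\<close>

lemma singular_set_flat_disc:
  assumes "r > 0"
  shows "singular_set (flat_disc p r) = {p}"
proof -
  have iff: "graph_map (plane_through p) q \<in> singular_set (flat_disc p r) \<longleftrightarrow> q = hproj p"
    if "q \<in> ball (hproj p) r" for q
    using singular_graph_iff[OF local_graph_flat_disc that]
    by (auto simp: contact_plane_through hproj_def prod_eq_iff)
  show ?thesis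
  proof (intro equalityI subsetI)
    fix m assume m: "m \<in> singular_set (flat_disc p r)"
    then obtain q where q: "q \<in> ball (hproj p) r" "m = graph_map (plane_through p) q"
      by (auto simp: singular_set_def flat_disc_def)
    then show "m \<in> {p}" using iff[OF q(1)] m by simp
  next
    fix m assume "m \<in> {p}"
    then show "m \<in> singular_set (flat_disc p r)" using iff[of "hproj p"] assms by simp
  qed
qed

lemma regular_part_flat_disc:
  assumes "r > 0"
  shows "regular_part (flat_disc p r) = graph_map (plane_through p) ` (ball (hproj p) r - {hproj p})"
proof -
  have "inj (graph_map (plane_through p))"
    by (rule inj_on_inverseI[where g = hproj]) simp
  then show ?thesis
    unfolding regular_part_def singular_set_flat_disc[OF assms] unfolding flat_disc_def
    by (simp add: image_set_diff)
qed

text \<open>For the same reason the characteristic lines are the rays from \<open>p\<close>. The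
  lifted outward unit vector is annihilated by the contact form, so its length in
  \<open>hmetric\<close> is that of its projection.\<close>

lemma char_field_flat_disc:
  assumes "r > 0"
  shows "char_field (flat_disc p r) (regular_part (flat_disc p r)) (radial_field p)"
  unfolding char_field_def
proof (intro conjI ballI)
  show "openin (top_of_set (flat_disc p r)) (regular_part (flat_disc p r))"
    unfolding regular_part_def singular_set_flat_disc[OF assms] by (simp add: openin_delete)
  let ?O = "- {hproj p}"
  let ?E = "\<lambda>q. let v = q - hproj p; n = sqrt (fst v * fst v + snd v * snd v) in
     (fst v / n, snd v / n, (fst (snd p) * fst v - fst p * snd v) / n)"
  have pos: "fst (q - hproj p) * fst (q - hproj p) + snd (q - hproj p) * snd (q - hproj p) > 0" if "q \<in> ?O" for q
    using that sum_squares_gt_zero_iff[of "fst (q - hproj p)" "snd (q - hproj p)"] by (auto simp: prod_eq_iff)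
  have o: "open ?O" by (rule open_Compl[OF closed_singleton])
  have "Cinf_on ?O ?E"
    unfolding Let_def using pos
    by (intro Cinf_intros o) (auto simp: less_imp_neq[symmetric])
  moreover have "radial_field p = (\<lambda>m. ?E (hproj m))" by (simp add: radial_field_def fun_eq_iff)
  moreover have "open (hproj -` ?O)" by (rule open_vimage_hproj[OF o])
  ultimately have sm: "Cinf_on (hproj -` ?O) (radial_field p)"
    using Cinf_on_compose[OF _ _ Cinf_on_bounded_linear[OF _ bounded_linear_hproj], of "hproj -` ?O" ?O ?E] by auto
  show "Cinf_along (regular_part (flat_disc p r)) (radial_field p)"
    unfolding Cinf_along_def
  proof (intro ballI exI conjI)
    show "open (hproj -` ?O)" by (rule open_vimage_hproj[OF o])
    show "Cinf_on (hproj -` ?O) (radial_field p)" by (rule sm)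
  qed (auto simp: regular_part_flat_disc[OF assms])
  show "regular_part (flat_disc p r) \<subseteq> regular_part (flat_disc p r)" ..
  fix m assume "m \<in> regular_part (flat_disc p r)"
  then obtain q where q: "q \<in> ball (hproj p) r" "q \<noteq> hproj p" "m = graph_map (plane_through p) q"
    unfolding regular_part_flat_disc[OF assms] by blast
  define v where "v = q - hproj p"
  define n where "n = sqrt (fst v * fst v + snd v * snd v)"
  have n: "n > 0" "n * n = fst v * fst v + snd v * snd v"
    using pos[of q] q(2) by (simp_all add: n_def v_def)
  define w where "w = (fst v / n, snd v / n)"
  have e: "radial_field p m = (fst w, snd w, frechet_derivative (plane_through p) (at q) w)"
    unfolding radial_field_def q(3) hproj_graph_map frechet_derivative_plane_through w_def
      Let_def v_def[symmetric] n_def[symmetric]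
    by (simp add: diff_divide_distrib)
  have cf: "contact_form m (radial_field p m) = 0"
    unfolding e unfolding q(3) contact_form_graph[OF Cinf_on_plane_through[OF open_ball] q(1)] contact_plane_through
    by (simp add: w_def v_def hproj_def algebra_simps flip: add_divide_distrib)
  have "radial_field p m \<in> tangent_space (flat_disc p r) m"
    unfolding e unfolding q(3) tangent_space_graph[OF local_graph_flat_disc q(1)] by (rule range_eqI, rule refl)
  then show "radial_field p m \<in> tangent_space (flat_disc p r) m \<inter> contact_plane m"
    using cf by (simp add: contact_plane_def)
  have "fst w * fst w + snd w * snd w = (fst v * fst v + snd v * snd v) / (n * n)"
    by (simp add: w_def add_divide_distrib)
  also have "\<dots> = 1" unfolding n(2)[symmetric] using n(1) by simp
  finally show "hmetric m (radial_field p m) (radial_field p m) = 1"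
    unfolding hmetric_def cf by (simp add: e)
qed

section \<open>Polar coordinates as normal coordinates\<close>

definition polar_map :: "heis \<Rightarrow> real \<times> real \<Rightarrow> real \<times> real" where
  "polar_map p = (\<lambda>(x, y). hproj p + (x * cos y, x * sin y))"

definition polar_chart :: "heis \<Rightarrow> real \<times> real \<Rightarrow> heis" where
  "polar_chart p w = graph_map (plane_through p) (polar_map p w)"

lemma polar_map_has_derivative:
  "(polar_map p has_derivative (\<lambda>v. (fst v * cos y - snd v * (x * sin y), fst v * sin y + snd v * (x * cos y)))) (at (x, y))"
  unfolding polar_map_def case_prod_beta
  by (auto intro!: derivative_eq_intros simp: algebra_simps)

lemma frechet_derivative_polar_chart:
  "frechet_derivative (polar_chart p) (at (x, y)) v =
     (let c = fst v * cos y - snd v * (x * sin y); d = fst v * sin y + snd v * (x * cos y)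
      in (c, d, fst (snd p) * c - fst p * d))"
proof -
  have "((\<lambda>w. graph_map (plane_through p) (polar_map p w)) has_derivative
      (\<lambda>v. let c = fst v * cos y - snd v * (x * sin y); d = fst v * sin y + snd v * (x * cos y)
      in (c, d, fst (snd p) * c - fst p * d))) (at (x, y))"
    using has_derivative_compose[OF polar_map_has_derivative graph_map_has_derivative[OF plane_through_has_derivative]]
    by (simp add: Let_def)
  from fun_cong[OF frechet_derivative_at[OF this], of v] show ?thesis
    unfolding polar_chart_def by simp
qed

text \<open>An angular window of width \<open>2 * pi\<close> makes polar coordinates injective, and
  the free centre \<open>\<theta>\<close> lets such charts cover every direction. Invariance of
  domain provides the open image and the continuous inverse, so no formula for the angle is
  required.\<close>

lemma local_param_polar_chart:
  fixes \<theta> :: real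
  assumes "r > 0"
  defines "W \<equiv> {0<..<r} \<times> {\<theta> - pi<..<\<theta> + pi}"
  shows "local_param (flat_disc p r) W (polar_chart p)"
    and "polar_chart p ` W \<subseteq> regular_part (flat_disc p r)"
proof -
  have W: "open W" unfolding W_def by (intro open_Times) auto
  have pm: "Cinf_on W (polar_map p)"
    unfolding polar_map_def case_prod_beta by (intro Cinf_intros W)
  have pc: "Cinf_on W (polar_chart p)" unfolding polar_chart_def
    unfolding graph_map_def plane_through_def by (intro Cinf_intros W pm)
  have dist: "dist (polar_map p w) (hproj p) = fst w" if "w \<in> W" for w
  proof -
    have "(fst w * cos (snd w))\<^sup>2 + (fst w * sin (snd w))\<^sup>2 = (fst w)\<^sup>2 * ((sin (snd w))\<^sup>2 + (cos (snd w))\<^sup>2)"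
      by (simp only: power_mult_distrib distrib_left add.commute)
    then show ?thesis
      using that by (auto simp: polar_map_def dist_norm norm_prod_def case_prod_beta W_def)
  qed
  have inj: "inj_on (polar_map p) W"
  proof (rule inj_onI)
    fix w w' assume w: "w \<in> W" "w' \<in> W" "polar_map p w = polar_map p w'"
    have x: "fst w = fst w'" using dist w by metis
    moreover have "fst w > 0" using w(1) by (auto simp: W_def)
    ultimately have "sin (snd w) = sin (snd w')" "cos (snd w) = cos (snd w')"
      using w(3) by (auto simp: polar_map_def case_prod_beta)
    then obtain n :: int where n: "snd w = snd w' + 2 * pi * n" using sin_cos_eq_iff by metis
    moreover have "\<bar>snd w - snd w'\<bar> < 2 * pi" using w by (auto simp: W_def)
    ultimately have "\<bar>2 * pi * n\<bar> < 2 * pi * 1" by simp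
    then have "\<bar>real_of_int n\<bar> < 1" unfolding abs_mult by simp
    then have "n = 0" by linarith
    then show "w = w'" using n x by (simp add: prod_eq_iff)
  qed
  have cont: "continuous_on W (polar_map p)" using Cinf_on_imp_continuous_on[OF pm] .
  have im: "open (polar_map p ` W)" using invariance_of_domain[OF cont W inj] .
  obtain g where g: "homeomorphism W (polar_map p ` W) (polar_map p) g"
    using invariance_of_domain_homeomorphism[OF W cont _ inj] by auto
  have sub: "polar_map p ` W \<subseteq> ball (hproj p) r - {hproj p}"
  proof
    fix q assume "q \<in> polar_map p ` W"
    then obtain w where w: "w \<in> W" "q = polar_map p w" by blast
    have "0 < fst w" "fst w < r" using w(1) by (auto simp: W_def)
    then show "q \<in> ball (hproj p) r - {hproj p}" using dist[OF w(1)] w(2) by (auto simp: dist_commute)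
  qed
  show reg: "polar_chart p ` W \<subseteq> regular_part (flat_disc p r)"
    unfolding regular_part_flat_disc[OF assms(1)] polar_chart_def using sub by blast
  show "local_param (flat_disc p r) W (polar_chart p)"
    unfolding local_param_def
  proof (intro conjI ballI)
    fix w assume w: "w \<in> W"
    obtain x y where xy: "w = (x, y)" by (cases w)
    have x: "x > 0" using w by (auto simp: xy W_def)
    have "(polar_chart p has_derivative frechet_derivative (polar_chart p) (at w)) (at w)"
      using Cinf_on_has_derivative[OF pc w] .
    then have lin: "linear (frechet_derivative (polar_chart p) (at w))" by (rule has_derivative_linear)
    show "inj (frechet_derivative (polar_chart p) (at w))"
      unfolding linear_injective_0[OF lin]
    proof (intro allI impI)
      fix v :: "real \<times> real"
      assume "frechet_derivative (polar_chart p) (at w) v = 0"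
      then have 0: "fst v * cos y - snd v * (x * sin y) = 0" "fst v * sin y + snd v * (x * cos y) = 0"
        unfolding xy frechet_derivative_polar_chart by (auto simp: Let_def zero_prod_def)
      have "fst v * ((cos y)\<^sup>2 + (sin y)\<^sup>2) = (fst v * cos y - snd v * (x * sin y)) * cos y + (fst v * sin y + snd v * (x * cos y)) * sin y"
        by algebra
      moreover have "snd v * x * ((cos y)\<^sup>2 + (sin y)\<^sup>2) = (fst v * sin y + snd v * (x * cos y)) * cos y - (fst v * cos y - snd v * (x * sin y)) * sin y"
        by algebra
      ultimately show "v = 0" unfolding 0 using x by (simp add: prod_eq_iff)
    qed
  next
    have "polar_chart p ` W = flat_disc p r \<inter> hproj -` (polar_map p ` W)"
    proof (intro equalityI subsetI)
      fix m assume "m \<in> polar_chart p ` W"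
      then obtain w where w: "w \<in> W" "m = graph_map (plane_through p) (polar_map p w)"
        unfolding polar_chart_def by blast
      then have "polar_map p w \<in> ball (hproj p) r" using sub by blast
      then show "m \<in> flat_disc p r \<inter> hproj -` (polar_map p ` W)"
        using w by (simp add: flat_disc_def)
    next
      fix m assume m: "m \<in> flat_disc p r \<inter> hproj -` (polar_map p ` W)"
      then obtain w where "w \<in> W" "hproj m = polar_map p w" by blast
      moreover have "m = graph_map (plane_through p) (hproj m)" using m by (auto simp: flat_disc_def)
      ultimately show "m \<in> polar_chart p ` W" unfolding polar_chart_def by (metis image_eqI)
    qed
    then show "openin (top_of_set (flat_disc p r)) (polar_chart p ` W)"
      using open_vimage_hproj[OF im] by (simp add: openin_open_Int)
    have "homeomorphism W (polar_chart p ` W) (polar_chart p) (\<lambda>m. g (hproj m))"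
    proof (rule homeomorphismI)
      show "continuous_on W (polar_chart p)" using Cinf_on_imp_continuous_on[OF pc] .
      have "continuous_on (polar_map p ` W) g" using g by (simp add: homeomorphism_def)
      then show "continuous_on (polar_chart p ` W) (\<lambda>m. g (hproj m))"
        by (rule continuous_on_compose2[OF _ continuous_on_hproj]) (auto simp: polar_chart_def)
    qed (use g in \<open>auto simp: homeomorphism_def polar_chart_def\<close>)
    then show "\<exists>\<psi>. homeomorphism W (polar_chart p ` W) (polar_chart p) \<psi>" by blast
  qed (use W pc in auto)
qed

text \<open>The angular coordinate field at radius \<open>x\<close> is \<open>x e_2 + x^2 T\<close>.
  Division by \<open>x^2\<close> exhibits \<open>e_2 / x + T\<close> as tangent, so
  \<open>alpha = 1 / x\<close>.\<close>

lemma alpha_fun_flat_disc: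
  fixes p :: heis and x y r :: real
  assumes "0 < x" "x < r"
  defines "m \<equiv> polar_chart p (x, y)"
  shows "radial_field p m = frechet_derivative (polar_chart p) (at (x, y)) (1, 0)"
    and "(1 / x) *\<^sub>R hJ m (radial_field p m) + hT = (1 / x\<^sup>2) *\<^sub>R frechet_derivative (polar_chart p) (at (x, y)) (0, 1)"
    and "alpha_fun (flat_disc p r) (radial_field p) m = 1 / x"
proof -
  define q where "q = polar_map p (x, y)"
  have m: "m = graph_map (plane_through p) q" by (simp add: m_def polar_chart_def q_def)
  have diff: "hproj m - hproj p = (x * cos y, x * sin y)"
    by (simp add: m q_def polar_map_def)
  have "x * cos y * (x * cos y) + x * sin y * (x * sin y) = x\<^sup>2 * ((sin y)\<^sup>2 + (cos y)\<^sup>2)"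
    by algebra
  then have n: "sqrt (x * cos y * (x * cos y) + x * sin y * (x * sin y)) = x"
    using assms(1) by simp
  have rf: "radial_field p m = (cos y, sin y, fst (snd p) * cos y - fst p * sin y)"
    unfolding radial_field_def diff Let_def fst_conv snd_conv n
    using assms(1) by (simp add: field_simps)
  then show "radial_field p m = frechet_derivative (polar_chart p) (at (x, y)) (1, 0)"
    by (simp add: frechet_derivative_polar_chart Let_def)
  have mc: "m = (fst p + x * cos y, fst (snd p) + x * sin y, plane_through p q)"
    by (simp add: m q_def polar_map_def graph_map_def hproj_def)
  have sc: "sin y * sin y + cos y * cos y = 1" using sin_cos_squared_add3[of y] by (simp add: add.commute)
  \<comment> \<open>The last coordinate is that of the tangent vector with the same projection plus
    the defect \<open>1 - a * x\<close>; tangency means that the defect is 0.\<close>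
  have J: "a *\<^sub>R hJ m (radial_field p m) + hT =
     (a * (- sin y), a * cos y, fst (snd p) * (a * (- sin y)) - fst p * (a * cos y) + (1 - a * x))" for a
  proof -
    have "x * (sin y * sin y) + x * (cos y * cos y) = x" using sc by (metis distrib_left mult.right_neutral)
    then have "a * x = a * (x * (sin y * sin y) + x * (cos y * cos y))" by simp
    then show ?thesis unfolding hJ_def rf by (simp add: mc hT_def algebra_simps)
  qed
  show "(1 / x) *\<^sub>R hJ m (radial_field p m) + hT = (1 / x\<^sup>2) *\<^sub>R frechet_derivative (polar_chart p) (at (x, y)) (0, 1)"
    unfolding J frechet_derivative_polar_chart using assms(1)
    by (simp add: Let_def power2_eq_square field_simps)
  have "dist (hproj p) q = x"
    using n assms(1) by (simp add: q_def polar_map_def dist_norm norm_prod_def power2_eq_square)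
  then have q: "q \<in> ball (hproj p) r" using assms(2) by simp
  have "a *\<^sub>R hJ m (radial_field p m) + hT \<in> tangent_space (flat_disc p r) m \<longleftrightarrow> a = 1 / x" for a
    unfolding J unfolding m tangent_space_graph[OF local_graph_flat_disc q] frechet_derivative_plane_through
    using assms(1) by (auto simp: image_iff field_simps)
  then show "alpha_fun (flat_disc p r) (radial_field p) m = 1 / x"
    unfolding alpha_fun_def by simp
qed

text \<open>Charts for different points differ only in their angular window, so one function,
  constantly 0, serves as \<open>\<zeta>\<close> for all of them.\<close>

lemma normal_coords_flat_disc:
  assumes "0 < r" "m \<in> regular_part (flat_disc p r)"
  obtains W \<phi> where "normal_coords (flat_disc p r) (radial_field p) W \<phi> (\<lambda>_. 0)" "m \<in> \<phi> ` W"
proof -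
  obtain q where q: "q \<in> ball (hproj p) r" "q \<noteq> hproj p" "m = graph_map (plane_through p) q"
    using assms(2) unfolding regular_part_flat_disc[OF assms(1)] by blast
  define \<rho> where "\<rho> = norm (q - hproj p)"
  have rho: "0 < \<rho>" "\<rho> < r" using q by (simp_all add: \<rho>_def dist_norm norm_minus_commute)
  have "(fst (q - hproj p) / \<rho>)\<^sup>2 + (snd (q - hproj p) / \<rho>)\<^sup>2 = ((fst (q - hproj p))\<^sup>2 + (snd (q - hproj p))\<^sup>2) / \<rho>\<^sup>2"
    by (simp add: power_divide add_divide_distrib)
  also have "(fst (q - hproj p))\<^sup>2 + (snd (q - hproj p))\<^sup>2 = \<rho>\<^sup>2"
    by (simp add: \<rho>_def norm_prod_def)
  finally have "(fst (q - hproj p) / \<rho>)\<^sup>2 + (snd (q - hproj p) / \<rho>)\<^sup>2 = 1" using rho by simp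
  then obtain \<theta> where th: "fst (q - hproj p) / \<rho> = cos \<theta>" "snd (q - hproj p) / \<rho> = sin \<theta>"
    using sincos_total_2pi by metis
  have qpol: "q = polar_map p (\<rho>, \<theta>)"
    using rho by (simp add: polar_map_def prod_eq_iff th[symmetric])
  let ?W = "{0<..<r} \<times> {\<theta> - pi<..<\<theta> + pi}"
  have reg: "polar_chart p ` ?W \<subseteq> regular_part (flat_disc p r)"
    by (rule local_param_polar_chart[OF assms(1)])
  have lp: "local_param (flat_disc p r) ?W (polar_chart p)"
    by (rule local_param_polar_chart[OF assms(1)])
  have cf: "char_field (flat_disc p r) (polar_chart p ` ?W) (radial_field p)"
    using char_field_flat_disc[OF assms(1)] reg lp unfolding char_field_def local_param_def Cinf_along_def
    by (meson IntI subsetD IntE)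
  have tI: "type_I_coords (flat_disc p r) (radial_field p) ?W (polar_chart p) (\<lambda>_. 0)"
    unfolding type_I_coords_def using lp cf alpha_fun_flat_disc(1,3)[where p = p and r = r] by auto
  have "normal_coords (flat_disc p r) (radial_field p) ?W (polar_chart p) (\<lambda>_. 0)"
    unfolding normal_coords_def
  proof (intro conjI tI, safe)
    fix x y assume "x \<in> {0<..<r}" "y \<in> {\<theta> - pi<..<\<theta> + pi}"
    then have x: "0 < x" "x < r" by auto
    show "let a = alpha_fun (flat_disc p r) (radial_field p) (polar_chart p (x, y)) in
        e2_hat (flat_disc p r) (radial_field p) (polar_chart p (x, y)) =
          (a\<^sup>2 / sqrt (1 + a\<^sup>2)) *\<^sub>R frechet_derivative (polar_chart p) (at (x, y)) (0, 1)"
      unfolding Let_def e2_hat_def alpha_fun_flat_disc(3)[OF x] alpha_fun_flat_disc(2)[OF x]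
      by (simp add: power_divide)
  qed
  moreover have "m \<in> polar_chart p ` ?W"
    unfolding q(3) qpol using rho by (intro image_eqI[of _ _ "(\<rho>, \<theta>)"]) (auto simp: polar_chart_def)
  ultimately show thesis by (rule that)
qed

text \<open>The group inverse of \<open>p\<close> is \<open>- p\<close>. Left translation by it
  respects the contact planes and so takes the contact plane through \<open>p\<close> to the one
  through the origin, which is \<open>z = 0\<close>.\<close>

lemma hmul_inverse_flat_disc:
  "hmul (- fst p, - fst (snd p), - snd (snd p)) ` flat_disc p r = flat_disc 0 r"
proof -
  let ?g = "hmul (- fst p, - fst (snd p), - snd (snd p))"
  have *: "?g (graph_map (plane_through p) q) = graph_map (plane_through 0) (q - hproj p)" for q
    by (cases q) (simp add: graph_map_def plane_through_def hproj_def algebra_simps)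
  have "?g ` flat_disc p r = graph_map (plane_through 0) ` ((\<lambda>q. q - hproj p) ` ball (hproj p) r)"
    unfolding flat_disc_def image_image * ..
  also have "(\<lambda>q. q - hproj p) ` ball (hproj p) r = ball (hproj 0) r"
  proof -
    have "(\<lambda>q. q - hproj p) ` ball (hproj p) r = (+) (- hproj p) ` ball (hproj p) r" by auto
    also have "\<dots> = ball 0 r" by (simp only: ball_translation[symmetric] right_minus_eq add.left_inverse)
    finally show ?thesis by (simp add: hproj_def zero_prod_def)
  qed
  finally show ?thesis by (simp add: flat_disc_def)
qed

text \<open>The disc will arise as an open piece of a p-minimal surface and inherits p-minimality
  from it, hence the second hypothesis.\<close>

lemma flat_disc_properties:
  assumes "r > 0" "p_minimal (flat_disc p r)"
  shows "special_type_I (flat_disc p r)"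
    and "has_zeta1_invariant (flat_disc p r) (radial_field p) (\<lambda>_. 0)"
    and "\<exists>g. hmul g p = 0 \<and> openin (top_of_set graph_zero) (hmul g ` flat_disc p r) \<and>
              singular_set (hmul g ` flat_disc p r) = {0}"
proof -
  show "special_type_I (flat_disc p r)"
    unfolding special_type_I_def
  proof (intro conjI assms(2) ballI)
    fix q assume "q \<in> regular_part (flat_disc p r)"
    then obtain W \<phi> where "normal_coords (flat_disc p r) (radial_field p) W \<phi> (\<lambda>_. 0)" "q \<in> \<phi> ` W"
      using normal_coords_flat_disc[OF assms(1)] by blast
    then show "\<exists>e W \<phi> c. type_I_coords (flat_disc p r) e W \<phi> c \<and> q \<in> \<phi> ` W"
      unfolding normal_coords_def by blast
  qed
  show "has_zeta1_invariant (flat_disc p r) (radial_field p) (\<lambda>_. 0)"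
    unfolding has_zeta1_invariant_def
    using char_field_flat_disc[OF assms(1)] normal_coords_flat_disc[OF assms(1)] by metis
  let ?g = "(- fst p, - fst (snd p), - snd (snd p))"
  have "hmul ?g p = 0" by (cases p) (simp add: zero_prod_def)
  moreover have "flat_disc 0 r = graph_zero \<inter> hproj -` ball (hproj 0) r"
  proof (intro equalityI subsetI)
    fix m assume "m \<in> flat_disc 0 r"
    then show "m \<in> graph_zero \<inter> hproj -` ball (hproj 0) r"
      by (auto simp: flat_disc_def graph_zero_def graph_map_def plane_through_def hproj_def)
  next
    fix m assume m: "m \<in> graph_zero \<inter> hproj -` ball (hproj 0) r"
    then have "m = graph_map (plane_through 0) (hproj m)"
      by (auto simp: graph_zero_def graph_map_def plane_through_def hproj_def)
    then show "m \<in> flat_disc 0 r" using m unfolding flat_disc_def by blast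
  qed
  then have "openin (top_of_set graph_zero) (flat_disc 0 r)"
    using open_vimage_hproj[OF open_ball] by (simp add: openin_open_Int)
  ultimately show "\<exists>g. hmul g p = 0 \<and> openin (top_of_set graph_zero) (hmul g ` flat_disc p r) \<and>
              singular_set (hmul g ` flat_disc p r) = {0}"
    using hmul_inverse_flat_disc[of p r] singular_set_flat_disc[OF assms(1), of 0] by metis
qed


section \<open>The structure of the singular set\<close>

text \<open>A column turned by a right angle annihilates itself, and by the vanishing determinant
  also the other column; a nonzero column is used if there is one.\<close>

lemma singular_matrix_left_kernel:
  fixes fx fy gx gy :: real
  assumes "fx * gy - fy * gx = 0"
  obtains n1 n2 where "n1\<^sup>2 + n2\<^sup>2 = 1" "n1 * fx + n2 * gx = 0" "n1 * fy + n2 * gy = 0"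
proof -
  have "\<exists>m1 m2. m1\<^sup>2 + m2\<^sup>2 > 0 \<and> m1 * fx + m2 * gx = 0 \<and> m1 * fy + m2 * gy = 0"
  proof (cases "fx = 0 \<and> gx = 0")
    case True
    show ?thesis
    proof (cases "fy = 0 \<and> gy = 0")
      case True
      with \<open>fx = 0 \<and> gx = 0\<close> show ?thesis by (intro exI[of _ 1] exI[of _ 0]) simp
    next
      case False
      with True show ?thesis
        by (intro exI[of _ gy] exI[of _ "- fy"]) (auto simp: sum_power2_gt_zero_iff)
    qed
  next
    case False
    with assms show ?thesis
      by (intro exI[of _ gx] exI[of _ "- fx"]) (auto simp: sum_power2_gt_zero_iff algebra_simps)
  qed
  then obtain m1 m2 where m: "m1\<^sup>2 + m2\<^sup>2 > 0" "m1 * fx + m2 * gx = 0" "m1 * fy + m2 * gy = 0" by blast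
  define N where "N = sqrt (m1\<^sup>2 + m2\<^sup>2)"
  have N: "N > 0" "N\<^sup>2 = m1\<^sup>2 + m2\<^sup>2" using m(1) by (simp_all add: N_def)
  show thesis
  proof (rule that[of "m1 / N" "m2 / N"])
    have "(m1 / N)\<^sup>2 + (m2 / N)\<^sup>2 = (m1\<^sup>2 + m2\<^sup>2) / N\<^sup>2" by (simp add: power_divide add_divide_distrib)
    also have "\<dots> = 1" unfolding N(2)[symmetric] using N(1) by simp
    finally show "(m1 / N)\<^sup>2 + (m2 / N)\<^sup>2 = 1" .
  qed (use m N in \<open>simp_all flip: add_divide_distrib\<close>)
qed

text \<open>The determinant of the derivative of the contact coefficients at the point decides which
  alternative holds.\<close>

lemma singular_point_dichotomy:
  assumes "p_minimal M" "p \<in> singular_set M"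
  obtains "is_curve_near (singular_set M) p"
  | V r where "open V" "r > 0" "M \<inter> V = flat_disc p r"
proof -
  have "smooth_surface M" using assms(1) by (simp add: p_minimal_def)
  then obtain V Q u where lg: "local_graph M V Q u" and pV: "p \<in> V"
    using singular_point_local_graph assms(2) by blast
  note l = local_graphD[OF lg]
  have pM: "p \<in> M" using assms(2) by (simp add: singular_set_def)
  define q0 where "q0 = hproj p"
  have q0: "q0 \<in> Q" "graph_map u q0 = p" using l(6,7) pM pV by (simp_all add: q0_def)
  have FG: "contact_x u q0 = 0" "contact_y u q0 = 0"
    using singular_graph_iff[OF lg q0(1)] q0(2) assms(2) by auto
  define det where "det = pd (1, 0) (contact_x u) q0 * pd (0, 1) (contact_y u) q0
       - pd (0, 1) (contact_x u) q0 * pd (1, 0) (contact_y u) q0"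
  show thesis
  proof (cases "det = 0")
    case True
    then obtain n1 n2 where n: "n1\<^sup>2 + n2\<^sup>2 = 1"
      "n1 * pd (1, 0) (contact_x u) q0 + n2 * pd (1, 0) (contact_y u) q0 = 0"
      "n1 * pd (0, 1) (contact_x u) q0 + n2 * pd (0, 1) (contact_y u) q0 = 0"
      using singular_matrix_left_kernel unfolding det_def by metis
    have "n1 * frechet_derivative (contact_x u) (at q0) v + n2 * frechet_derivative (contact_y u) (at q0) v = 0" for v
    proof -
      have lin: "linear (frechet_derivative (contact_x u) (at q0))" "linear (frechet_derivative (contact_y u) (at q0))"
        using Cinf_on_contact[OF l(2,3)] Cinf_on_has_derivative[OF _ q0(1)] has_derivative_linear by blast+
      have "n1 * frechet_derivative (contact_x u) (at q0) (a, b) + n2 * frechet_derivative (contact_y u) (at q0) (a, b)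
        = a * (n1 * pd (1, 0) (contact_x u) q0 + n2 * pd (1, 0) (contact_y u) q0)
        + b * (n1 * pd (0, 1) (contact_x u) q0 + n2 * pd (0, 1) (contact_y u) q0)" for a b
        by (subst (1 2) plane_linear_expand; (rule lin)?) (simp add: algebra_simps)
      from this[of "fst v" "snd v"] show ?thesis using n(2,3) by simp
    qed
    from degenerate_singular_point_curve[OF assms(1) lg q0(1) FG n(1) this]
    show thesis using that(1) q0(2) by simp
  next
    case False
    obtain r where r: "r > 0" "ball q0 r \<subseteq> Q"
      "\<And>q. q \<in> ball q0 r \<Longrightarrow> u q = u q0 + snd q0 * (fst q - fst q0) - fst q0 * (snd q - snd q0)"
      using nondegenerate_point_affine[OF assms(1) lg q0(1) FG] False unfolding det_def by metis
    have "u q0 = snd (snd p)" "fst q0 = fst p" "snd q0 = fst (snd p)"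
      using q0(2) by (auto simp: graph_map_def)
    then have "graph_map u q = graph_map (plane_through p) q" if "q \<in> ball q0 r" for q
      using r(3)[OF that] by (simp add: graph_map_def plane_through_def)
    moreover note lg' = local_graph_restrict[OF lg open_ball r(2)]
    ultimately have "M \<inter> (V \<inter> hproj -` ball q0 r) = flat_disc p r"
      unfolding local_graph_def flat_disc_def q0_def[symmetric] by (metis (no_types, lifting) image_cong)
    then show thesis using that(2)[OF local_graphD(1)[OF lg'] r(1)] by blast
  qed
qed

section \<open>From singular points to components\<close>

lemma singular_set_open_Int:
  assumes "open V"
  shows "singular_set (M \<inter> V) = singular_set M \<inter> V"
  using tangent_space_open[OF assms] unfolding singular_set_def by blast

text \<open>The homeomorphism to an interval would carry an isolated point to an open point of the
  real line.\<close>

lemma is_curve_near_not_isolated: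
  assumes "is_curve_near S p" "p \<in> S"
  shows "\<not> p isolated_in S"
proof
  assume "p isolated_in S"
  then obtain T where T: "open T" "T \<inter> S = {p}"
    by (rule isolated_inE)
  obtain U \<gamma> \<delta> where U: "open U" "p \<in> U" "homeomorphism {0<..<1::real} (S \<inter> U) \<gamma> \<delta>"
    using assms(1) unfolding is_curve_near_def by blast
  have "openin (top_of_set (S \<inter> U)) {p}"
    using T U(2) assms(2) by (auto simp: openin_open intro!: exI[of _ T])
  moreover have "homeomorphism (S \<inter> U) {0<..<1} \<delta> \<gamma>" by (rule homeomorphism_symD[OF U(3)])
  ultimately have "openin (top_of_set {0<..<1}) (\<delta> ` {p})"
    by (intro homeomorphism_imp_open_map)
  then have "open {\<delta> p}" using openin_open_trans open_greaterThanLessThan by fastforce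
  then show False using not_open_singleton by blast
qed

text \<open>An isolated point is both open and closed in its component, which is connected.\<close>

lemma component_of_isolated_point:
  fixes S :: "'a::t1_space set"
  assumes "p isolated_in S" "C \<in> components S" "p \<in> C"
  shows "C = {p}"
proof -
  have "p \<in> S" "C \<subseteq> S" "connected C"
    using assms in_components_subset in_components_connected by blast+
  obtain T where T: "open T" "T \<inter> S = {p}"
    using isolated_inE[OF assms(1)] .
  have "openin (top_of_set C) {p}"
    using T assms(3) \<open>C \<subseteq> S\<close> by (auto simp: openin_open intro!: exI[of _ T])
  moreover have "closedin (top_of_set C) {p}"
    by (rule closed_subset) (use assms(3) in auto)
  ultimately show ?thesis using \<open>connected C\<close> unfolding connected_clopen by blast
qed

text \<open>Each local arc \<open>S \<inter> U\<close> is connected and hence lies in the component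
  of its point. Near every point of \<open>C\<close>, therefore, \<open>S\<close> and
  \<open>C\<close> coincide, so other components cannot accumulate there.\<close>

lemma component_of_curve_points:
  assumes "C \<in> components S" and near: "\<And>p. p \<in> C \<Longrightarrow> is_curve_near S p"
  shows "C1_curve C \<and> openin (top_of_set S) C"
proof
  have CS: "C \<subseteq> S" using assms(1) in_components_subset by blast
  have arc: "\<exists>U \<gamma> \<delta>. open U \<and> p \<in> U \<and> \<gamma> C1_differentiable_on {0<..<1::real} \<and>
        (\<forall>t\<in>{0<..<1}. vector_derivative \<gamma> (at t) \<noteq> 0) \<and>
        homeomorphism {0<..<1} (S \<inter> U) \<gamma> \<delta> \<and> S \<inter> U = C \<inter> U" if "p \<in> C" for p
  proof -
    obtain U \<gamma> \<delta> where U: "open U" "p \<in> U" "\<gamma> C1_differentiable_on {0<..<1::real}"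
        "\<forall>t\<in>{0<..<1}. vector_derivative \<gamma> (at t) \<noteq> 0" "homeomorphism {0<..<1} (S \<inter> U) \<gamma> \<delta>"
      using near[OF \<open>p \<in> C\<close>] unfolding is_curve_near_def by blast
    have "connected (S \<inter> U)"
      using U(5) connected_continuous_image[of "{0<..<1::real}" \<gamma>] unfolding homeomorphism_def
      by (metis connected_Ioo)
    then have "S \<inter> U \<subseteq> C"
      using components_maximal[OF assms(1), of "S \<inter> U"] that CS U(2) by blast
    then have "S \<inter> U = C \<inter> U" using CS by blast
    with U show ?thesis by blast
  qed
  then show "C1_curve C" unfolding C1_curve_def by metis
  show "openin (top_of_set S) C"
  proof (subst openin_subopen, intro ballI)
    fix p assume "p \<in> C"
    then obtain U where U: "open U" "p \<in> U" "S \<inter> U = C \<inter> U" using arc by blast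
    show "\<exists>T. openin (top_of_set S) T \<and> p \<in> T \<and> T \<subseteq> C"
    proof (intro exI conjI)
      show "openin (top_of_set S) (S \<inter> U)" by (rule openin_open_Int[OF U(1)])
    qed (use \<open>p \<in> C\<close> CS U in auto)
  qed
qed

theorem theorem1p7:
  fixes M :: "heis set"
  assumes "p_minimal M"
  shows
    "(\<forall>C\<in>components (singular_set M).
        (\<exists>p. C = {p} \<and> p isolated_in singular_set M) \<or>
        (C1_curve C \<and> openin (top_of_set (singular_set M)) C)) \<and>
     (\<forall>p. p isolated_in singular_set M \<longrightarrow>
        (\<exists>V. open V \<and> p \<in> V \<and>
           special_type_I (M \<inter> V) \<and>
           (\<exists>e k. has_zeta1_invariant (M \<inter> V) e (\<lambda>_. k)) \<and>
           (\<exists>g. hmul g p = 0 \<and>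
              openin (top_of_set graph_zero) (hmul g ` (M \<inter> V)) \<and>
              singular_set (hmul g ` (M \<inter> V)) = {0})))"
proof (intro conjI ballI allI impI)
  fix C assume C: "C \<in> components (singular_set M)"
  show "(\<exists>p. C = {p} \<and> p isolated_in singular_set M) \<or>
        (C1_curve C \<and> openin (top_of_set (singular_set M)) C)"
  proof (cases "\<exists>p\<in>C. p isolated_in singular_set M")
    case True
    then show ?thesis using component_of_isolated_point[OF _ C] by blast
  next
    case False
    have "is_curve_near (singular_set M) p" if p: "p \<in> C" for p
    proof -
      have "p \<in> singular_set M" using C p in_components_subset by blast
      with assms show ?thesis
      proof (cases rule: singular_point_dichotomy)
        \<comment> \<open>A flat disc would make \<open>p\<close> an isolated singular point, which
          this branch excludes for points of \<open>C\<close>.\<close>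
        case (2 V r)
        have "singular_set M \<inter> V = {p}"
          using singular_set_open_Int[OF 2(1), of M] singular_set_flat_disc[OF 2(2), of p] 2(3) by simp
        then have "p isolated_in singular_set M"
          using 2(1) unfolding isolated_in_def by blast
        then show ?thesis using False p by blast
      qed
    qed
    then show ?thesis using component_of_curve_points[OF C] by blast
  qed
next
  fix p assume p: "p isolated_in singular_set M"
  then have pS: "p \<in> singular_set M" by (simp add: isolated_in_def)
  with assms show "\<exists>V. open V \<and> p \<in> V \<and>
           special_type_I (M \<inter> V) \<and>
           (\<exists>e k. has_zeta1_invariant (M \<inter> V) e (\<lambda>_. k)) \<and>
           (\<exists>g. hmul g p = 0 \<and>
              openin (top_of_set graph_zero) (hmul g ` (M \<inter> V)) \<and>
              singular_set (hmul g ` (M \<inter> V)) = {0})"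
  proof (cases rule: singular_point_dichotomy)
    case 1
    then show ?thesis using is_curve_near_not_isolated pS p by blast
  next
    case (2 V r)
    have "p_minimal (flat_disc p r)" using p_minimal_open_subset[OF assms 2(1)] 2(3) by simp
    note flat = flat_disc_properties[OF 2(2) this]
    have "p \<in> V"
      using singular_set_open_Int[OF 2(1), of M] singular_set_flat_disc[OF 2(2), of p] 2(3) by auto
    then show ?thesis using 2(1) flat unfolding 2(3)[symmetric] by blast
  qed
qed

end
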